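(* Let $X_1,\dots,X_n$ be i.i.d. $\mathrm N(0,\mathrm\Sigma)$ in $\mathbb R^p$, $X_i=(X_i^1,\dots,X_i^p)^T$, with $\mathbb E(X_i^j)^4\le 1$ for all $i,j$, and with $\mathrm\Sigma\in\mathcal C_{\varepsilon_0}$, where $\varepsilon_0>0$ is known and independent of $p$, and $\mathcal C_{\varepsilon_0}$ is the set of $p\times p$ covariance matrices $\mathrm M$ with $\varepsilon_0\le\lambda_{\min}(\mathrm M)\le\lambda_{\max}(\mathrm M)\le\varepsilon_0^{-1}$. Let $\mathrm Y=\frac1n\sum_{l=1}^nX_lX_l^T$, $Y=\mathrm{vec}(\mathrm Y)\in\mathbb R^{p^2}$, and $\sigma_n\in[0,1]$. Let $\hat\pi,\hat{\mathrm\Sigma},\hat r,r^2(I,\mathrm\Sigma),r^2(\mathrm\Sigma),\Theta_{\rm eb}(t)$ be as in the context (banding structure), and let $H'=4$, $\bar c_1=3\varepsilon_0^4/320$, $\bar c_2=2$, $c_2=\alpha/16$, $c_3=6/\alpha+4\varkappa$, $C_\nu=e^\nu/(e^\nu-1)$. Then there exist constants $M_0,M_1,M_2,M_3,H_0,H_1,H_2,H_3,m_0,m_1,m_2,m_3>0$, not depending on $n,p,\sigma_n,\mathrm\Sigma$, such that for any $M,t\ge0$, with $\hat R_M^2=(t+1)M_2\hat r^2+(t+2)M\sigma_n^2$ and $q_n=H'e^{-\bar c_1n\sigma_n^2+\bar c_2\log p}$, $$\sup_{\mathrm\Sigma\in\mathcal C_{\varepsilon_0}}\mathbb E_{\mathrm\Sigma}\hat\pi\big(\|\mathit\Sigma-\mathrm\Sigma\|^2\ge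 M_0r^2(\mathrm\Sigma)+M\sigma_n^2|Y\big)\le q_n+H_0e^{-m_0M},$$ $$\sup_{\mathrm\Sigma\in\mathcal C_{\varepsilon_0}}\mathbb P_{\mathrm\Sigma}\big(\|\hat{\mathrm\Sigma}-\mathrm\Sigma\|^2\ge M_1r^2(\mathrm\Sigma)+M\sigma_n^2\big)\le q_n+H_1e^{-m_1M},$$ $$\sup_{\mathrm\Sigma\in\mathcal C_{\varepsilon_0}}\mathbb E_{\mathrm\Sigma}\hat\pi\big(I:\ r^2(I,\mathrm\Sigma)\ge c_3r^2(\mathrm\Sigma)+M\sigma_n^2|Y\big)\le q_n+C_\nu e^{-c_2M},$$ $$\sup_{\mathrm\Sigma\in\mathcal C_{\varepsilon_0}}\mathbb P_{\mathrm\Sigma}\big(\hat r^2\ge M_3r^2(\mathrm\Sigma)+(M+1)\sigma_n^2\big)\le q_n+H_3e^{-m_3M},$$ $$\sup_{\mathrm\Sigma\in\mathcal C_{\varepsilon_0}\cap\Theta_{\rm eb}(t)}\mathbb P_{\mathrm\Sigma}\big(\mathrm\Sigma\notin B(\hat{\mathrm\Sigma},\hat R_M)\big)\le q_n+H_2e^{-m_2M}.$$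
   Context: Matrices are identified with their vectorizations in $\mathbb R^{p^2}$; $\|\cdot\|$ is the Frobenius norm; $B(\mathrm S,R)$ is the closed Frobenius ball of radius $R$ around $\mathrm S$. $\mathbb P_{\mathrm\Sigma},\mathbb E_{\mathrm\Sigma}$ are probability and expectation when the true covariance is $\mathrm\Sigma$; $\mathit\Sigma$ is the variable in the data dependent measures. The model is written $Y_{ij}=\Sigma_{ij}+\sigma_n\xi_{ij}$, $i,j\in\{1,\dots,p\}$, with $\sigma_n\xi_{ij}=Y_{ij}-\Sigma_{ij}$. Banding structure: $I\in\mathcal I=\{0,1,\dots,p\}$, $\mathbb L_I=\{x\in\mathbb R^{p\times p}:x_{ij}=x_{ji}\ \forall i,j;\ x_{ij}=0\text{ if }|i-j|>I\}$, $\mathrm P_I$ the orthogonal projection onto $\mathbb L_I$, $d_I=\rho(I)=p+I(p-(I+1)/2)$. With $\nu>0$ fixed, $\sum_Ie^{-\nu\rho(I)}\le C_\nu=e^\nu/(e^\nu-1)$. Let $\alpha=\min\{1,5\varepsilon_0^2/4\}$ and fix $\varkappa>(32\nu+10+\alpha)/(4\alpha)$. Data dependent measures: $$\tilde\pi(I|Y)=\frac{e^{-\varkappa\rho(I)}\exp\{-\|Y-\mathrm P_IY\|^2/(2\sigma_n^2)\}}{\sum_{J\in\mathcal I}e^{-\varkappa\rho(J)}\exp\{-\|Y-\mathrm P_JY\|^2/(2\sigma_n^2)\}},\quad I\in\mathcal I.$$ Let $Z$ have an arbitrary fixed mean-zero law $\mathbb P_Z$ on $\mathbb R^{p^2}$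 with $\mathbb E_Z\exp\{\alpha\|\mathrm P_IZ\|^2\}\le e^{d_I}$ for all $I$; $\tilde\pi_I(\mathit\Sigma\in B|Y)=\mathbb P_Z(\mathrm P_Iy+\sigma_n\mathrm P_IZ\in B)|_{y=Y}$. Then $\tilde\pi(\mathit\Sigma|Y)=\sum_I\tilde\pi_I(\mathit\Sigma|Y)\tilde\pi(I|Y)$ with mean $\sum_I(\mathrm P_IY)\tilde\pi(I|Y)$; $\hat I\in\arg\max_I\tilde\pi(I|Y)$; $\check\pi(I|Y)=1\{I=\hat I\}$, $\check\pi(\mathit\Sigma|Y)=\tilde\pi_{\hat I}(\mathit\Sigma|Y)$ with mean $\mathrm P_{\hat I}Y$. $\hat\pi$ denotes either $\tilde\pi$ or $\check\pi$, and $\hat{\mathrm\Sigma}$ the corresponding mean (the statement holds for both). $\hat r^2=\sigma_n^2+\sigma_n^2\rho(\hat I)$. Rates: $r^2(I,\mathrm\Sigma)=\sum_{|i-j|>I}\Sigma_{ij}^2+\sigma_n^2\rho(I)$, $r^2(\mathrm\Sigma)=\min_{I\in\mathcal I}r^2(I,\mathrm\Sigma)$. Put $\bar\tau=3(1+\varkappa\alpha)/\alpha$, fix $\delta\in(0,1)$, $\tau_0>\frac{1+\delta}{1-\delta}\bar\tau$; let $I_*=I_*(\mathrm\Sigma)$ be a minimizer over $I$ of $\sum_{|i-j|>I}\Sigma_{ij}^2+\tau_0\sigma_n^2\rho(I)$; $\Theta_{\rm eb}(t)=\{\mathrm\Sigma:\sum_{|i-j|>I_*}\Sigma_{ij}^2\le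 t\sigma_n^2(1+\rho(I_* ))\}$. *)

theory Defs
  imports
    "HOL-Probability.Probability"
    "Jordan_Normal_Form.Char_Poly"
begin

(* A p x p matrix, and equally its vectorization in R^(p^2), is a function on the index set
   {..<p} x {..<p}, with value undefined elsewhere (the carrier of the product space PiM).
   Rows and columns are numbered from 0. *)

definition idx :: "nat \<Rightarrow> (nat \<times> nat) set" where
  "idx p = {..<p} \<times> {..<p}"

definition mat_space :: "nat \<Rightarrow> (nat \<times> nat \<Rightarrow> real) measure" where
  "mat_space p = Pi\<^sub>M (idx p) (\<lambda>_. borel)"

definition frob :: "nat \<Rightarrow> (nat \<times> nat \<Rightarrow> real) \<Rightarrow> real" where
  "frob p x = L2_set x (idx p)"

definition mdiff :: "nat \<Rightarrow> (nat \<times> nat \<Rightarrow> real) \<Rightarrow> (nat \<times> nat \<Rightarrow> real) \<Rightarrow> nat \<times> nat \<Rightarrow> real" where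
  "mdiff p x y = (\<lambda>ij\<in>idx p. x ij - y ij)"

definition frob_cball :: "nat \<Rightarrow> (nat \<times> nat \<Rightarrow> real) \<Rightarrow> real \<Rightarrow> (nat \<times> nat \<Rightarrow> real) set" where
  "frob_cball p S R = {x \<in> space (mat_space p). frob p (mdiff p x S) \<le> R}"


section \<open>The Gaussian sample\<close>

definition std_normal_vec :: "nat \<Rightarrow> (nat \<Rightarrow> real) measure" where
  "std_normal_vec p = Pi\<^sub>M {..<p} (\<lambda>_. density lborel (\<lambda>x. ennreal (std_normal_density x)))"

(* N(0,S) is the law of A z, where z is a standard normal vector and A A^T = S. Such an A exists
   for every covariance matrix S, and the law of A z depends on A only through A A^T. *)
definition mvn :: "nat \<Rightarrow> (nat \<times> nat \<Rightarrow> real) \<Rightarrow> (nat \<Rightarrow> real) measure" where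
  "mvn p S =
    (let A = (SOME A. A \<in> carrier_mat p p \<and> A * transpose_mat A = Matrix.mat p p S)
     in distr (std_normal_vec p) (Pi\<^sub>M {..<p} (\<lambda>_. borel))
          (\<lambda>z. \<lambda>j\<in>{..<p}. \<Sum>k<p. A $$ (j, k) * z k))"

(* Law of the i.i.d. sample: observation l < n is the coordinate projection to l. *)
definition sample_law :: "nat \<Rightarrow> nat \<Rightarrow> (nat \<times> nat \<Rightarrow> real) \<Rightarrow> (nat \<Rightarrow> nat \<Rightarrow> real) measure" where
  "sample_law n p S = Pi\<^sub>M {..<n} (\<lambda>_. mvn p S)"

definition sample_cov :: "nat \<Rightarrow> nat \<Rightarrow> (nat \<Rightarrow> nat \<Rightarrow> real) \<Rightarrow> nat \<times> nat \<Rightarrow> real" where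
  "sample_cov n p X = (\<lambda>(i, j)\<in>idx p. (1 / real n) * (\<Sum>l<n. X l i * X l j))"

definition covariance_mat :: "nat \<Rightarrow> (nat \<times> nat \<Rightarrow> real) \<Rightarrow> bool" where
  "covariance_mat p S \<longleftrightarrow>
     S \<in> space (mat_space p) \<and>
     (\<forall>i<p. \<forall>j<p. S (i, j) = S (j, i)) \<and>
     (\<forall>u :: nat \<Rightarrow> real. 0 \<le> (\<Sum>i<p. \<Sum>j<p. u i * S (i, j) * u j))"

definition lambda_min :: "nat \<Rightarrow> (nat \<times> nat \<Rightarrow> real) \<Rightarrow> real" where
  "lambda_min p S = Min {k. eigenvalue (Matrix.mat p p S) k}"

definition lambda_max :: "nat \<Rightarrow> (nat \<times> nat \<Rightarrow> real) \<Rightarrow> real" where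
  "lambda_max p S = Max {k. eigenvalue (Matrix.mat p p S) k}"

definition cov_class :: "nat \<Rightarrow> real \<Rightarrow> (nat \<times> nat \<Rightarrow> real) set" where
  "cov_class p \<epsilon> =
    {S. covariance_mat p S \<and> \<epsilon> \<le> lambda_min p S \<and> lambda_min p S \<le> lambda_max p S \<and>
        lambda_max p S \<le> 1 / \<epsilon>}"

(* The condition E (X^j)^4 \<le> 1 constrains the true covariance, hence the range of the suprema. *)
definition moment_class :: "nat \<Rightarrow> (nat \<times> nat \<Rightarrow> real) set" where
  "moment_class p = {S. \<forall>j<p. (\<integral>\<^sup>+ x. ennreal (x j ^ 4) \<partial>mvn p S) \<le> 1}"


section \<open>Banding structure and rates\<close>

definition band_space :: "nat \<Rightarrow> nat \<Rightarrow> (nat \<times> nat \<Rightarrow> real) set" where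
  "band_space p I =
    {x \<in> space (mat_space p).
       (\<forall>i<p. \<forall>j<p. x (i, j) = x (j, i)) \<and>
       (\<forall>i<p. \<forall>j<p. \<bar>int i - int j\<bar> > int I \<longrightarrow> x (i, j) = 0)}"

(* Orthogonal projection onto band_space p I. *)
definition band_proj :: "nat \<Rightarrow> nat \<Rightarrow> (nat \<times> nat \<Rightarrow> real) \<Rightarrow> nat \<times> nat \<Rightarrow> real" where
  "band_proj p I x =
    (THE y. y \<in> band_space p I \<and>
       (\<forall>w\<in>band_space p I. (\<Sum>ij\<in>idx p. (x ij - y ij) * w ij) = 0))"

lemma band_proj_eq:
  "band_proj p I x =
    (\<lambda>(i, j)\<in>idx p. if \<bar>int i - int j\<bar> \<le> int I then (x (i, j) + x (j, i)) / 2 else 0)"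
    (is "_ = ?y")
  unfolding band_proj_def
proof (rule the_equality)
  let ?orth = "\<lambda>y. \<forall>w\<in>band_space p I. (\<Sum>ij\<in>idx p. (x ij - y ij) * w ij) = 0"
  have swap: "(\<Sum>ij\<in>idx p. f ij) = (\<Sum>ij\<in>idx p. f (snd ij, fst ij))"
    for f :: "nat \<times> nat \<Rightarrow> real"
    by (rule sum.reindex_bij_witness[of _ "\<lambda>ij. (snd ij, fst ij)" "\<lambda>ij. (snd ij, fst ij)"])
       (auto simp: idx_def)
  have y_mem: "?y \<in> band_space p I"
    by (auto simp: band_space_def mat_space_def space_PiM idx_def abs_minus_commute)
  have y_orth: "?orth ?y"
  proof
    fix w assume w: "w \<in> band_space p I"
    have "2 * (\<Sum>ij\<in>idx p. (x ij - ?y ij) * w ij) =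
        (\<Sum>ij\<in>idx p. (x ij - ?y ij) * w ij +
          (x (snd ij, fst ij) - ?y (snd ij, fst ij)) * w (snd ij, fst ij))"
      using swap[of "\<lambda>ij. (x ij - ?y ij) * w ij"] by (simp add: sum.distrib)
    also have "\<dots> = 0"
    proof (rule sum.neutral, safe)
      fix i j assume ij: "(i, j) \<in> idx p"
      then have w_sym: "w (j, i) = w (i, j)"
        and w_zero: "\<bar>int i - int j\<bar> > int I \<Longrightarrow> w (i, j) = 0"
        using w by (auto simp: band_space_def idx_def)
      show "(x (i, j) - ?y (i, j)) * w (i, j) +
          (x (snd (i, j), fst (i, j)) - ?y (snd (i, j), fst (i, j))) * w (snd (i, j), fst (i, j)) = 0"
        using ij w_sym w_zero
        by (cases "\<bar>int i - int j\<bar> \<le> int I")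
           (auto simp: idx_def abs_minus_commute[of "int j"] field_simps)
    qed
    finally show "(\<Sum>ij\<in>idx p. (x ij - ?y ij) * w ij) = 0" by simp
  qed
  show "?y \<in> band_space p I \<and> ?orth ?y" using y_mem y_orth by simp
  fix y assume y: "y \<in> band_space p I \<and> ?orth y"
  let ?d = "mdiff p y ?y"
  have d_mem: "?d \<in> band_space p I"
    using y y_mem by (auto simp: band_space_def mat_space_def space_PiM idx_def mdiff_def)
  have "(\<Sum>ij\<in>idx p. (?d ij)\<^sup>2) =
      (\<Sum>ij\<in>idx p. (x ij - ?y ij) * ?d ij) - (\<Sum>ij\<in>idx p. (x ij - y ij) * ?d ij)"
    unfolding sum_subtractf[symmetric]
    by (rule sum.cong) (auto simp: mdiff_def power2_eq_square algebra_simps)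
  also have "\<dots> = 0" using d_mem y y_orth by simp
  finally have "\<forall>ij\<in>idx p. (?d ij)\<^sup>2 = 0"
    by (subst (asm) sum_nonneg_eq_0_iff) (auto simp: idx_def)
  then have "\<And>ij. ij \<in> idx p \<Longrightarrow> y ij = ?y ij" by (simp add: mdiff_def)
  then show "y = ?y"
    using y y_mem by (intro PiE_ext[of y "idx p" "\<lambda>_. UNIV" ?y])
      (auto simp: band_space_def mat_space_def space_PiM)
qed

definition rho :: "nat \<Rightarrow> nat \<Rightarrow> real" where
  "rho p I = real p + real I * (real p - (real I + 1) / 2)"

definition bias2 :: "nat \<Rightarrow> nat \<Rightarrow> (nat \<times> nat \<Rightarrow> real) \<Rightarrow> real" where
  "bias2 p I S = (\<Sum>(i, j)\<in>{(i, j)\<in>idx p. \<bar>int i - int j\<bar> > int I}. (S (i, j))\<^sup>2)"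

definition rate2 :: "nat \<Rightarrow> real \<Rightarrow> nat \<Rightarrow> (nat \<times> nat \<Rightarrow> real) \<Rightarrow> real" where
  "rate2 p \<sigma> I S = bias2 p I S + \<sigma>\<^sup>2 * rho p I"

definition oracle_rate2 :: "nat \<Rightarrow> real \<Rightarrow> (nat \<times> nat \<Rightarrow> real) \<Rightarrow> real" where
  "oracle_rate2 p \<sigma> S = Min ((\<lambda>I. rate2 p \<sigma> I S) ` {0..p})"

(* Istar selects, for every matrix, one minimizer of the criterion with penalty factor tau. *)
definition tau_oracle :: "nat \<Rightarrow> real \<Rightarrow> real \<Rightarrow> ((nat \<times> nat \<Rightarrow> real) \<Rightarrow> nat) \<Rightarrow> bool" where
  "tau_oracle p \<sigma> \<tau> Istar \<longleftrightarrow>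
    (\<forall>S\<in>space (mat_space p).
       is_arg_min (\<lambda>I. bias2 p I S + \<tau> * \<sigma>\<^sup>2 * rho p I) (\<lambda>I. I \<in> {0..p}) (Istar S))"

definition Theta_eb ::
    "nat \<Rightarrow> real \<Rightarrow> ((nat \<times> nat \<Rightarrow> real) \<Rightarrow> nat) \<Rightarrow> real \<Rightarrow> (nat \<times> nat \<Rightarrow> real) set" where
  "Theta_eb p \<sigma> Istar t =
    {S \<in> space (mat_space p). bias2 p (Istar S) S \<le> t * \<sigma>\<^sup>2 * (1 + rho p (Istar S))}"


section \<open>Data dependent measures\<close>

definition alpha :: "real \<Rightarrow> real" where
  "alpha \<epsilon> = min 1 (5 * \<epsilon>\<^sup>2 / 4)"

definition tau_bar :: "real \<Rightarrow> real \<Rightarrow> real" where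
  "tau_bar \<epsilon> \<kappa> = 3 * (1 + \<kappa> * alpha \<epsilon>) / alpha \<epsilon>"

definition admissible_Z :: "nat \<Rightarrow> real \<Rightarrow> (nat \<times> nat \<Rightarrow> real) measure \<Rightarrow> bool" where
  "admissible_Z p a PZ \<longleftrightarrow>
     prob_space PZ \<and> sets PZ = sets (mat_space p) \<and>
     (\<forall>ij\<in>idx p. integrable PZ (\<lambda>z. z ij) \<and> (\<integral>z. z ij \<partial>PZ) = 0) \<and>
     (\<forall>I\<in>{0..p}. (\<integral>\<^sup>+ z. ennreal (exp (a * (frob p (band_proj p I z))\<^sup>2)) \<partial>PZ)
        \<le> ennreal (exp (rho p I)))"

(* For sigma = 0 the quotient in the exponent is 0 (x / 0 = 0). *)
definition idx_weight :: "nat \<Rightarrow> real \<Rightarrow> real \<Rightarrow> (nat \<times> nat \<Rightarrow> real) \<Rightarrow> nat \<Rightarrow> real" where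
  "idx_weight p \<kappa> \<sigma> y I =
    exp (- \<kappa> * rho p I) * exp (- (frob p (mdiff p y (band_proj p I y)))\<^sup>2 / (2 * \<sigma>\<^sup>2))"

definition pi_tilde_idx :: "nat \<Rightarrow> real \<Rightarrow> real \<Rightarrow> (nat \<times> nat \<Rightarrow> real) \<Rightarrow> nat \<Rightarrow> real" where
  "pi_tilde_idx p \<kappa> \<sigma> y I = idx_weight p \<kappa> \<sigma> y I / (\<Sum>J\<in>{0..p}. idx_weight p \<kappa> \<sigma> y J)"

(* Ihat is an estimator (measurable in the data) attaining the maximum of pi_tilde_idx; ties may
   be broken in any measurable way. *)
definition index_selector ::
    "nat \<Rightarrow> real \<Rightarrow> real \<Rightarrow> ((nat \<times> nat \<Rightarrow> real) \<Rightarrow> nat) \<Rightarrow> bool" where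
  "index_selector p \<kappa> \<sigma> Ihat \<longleftrightarrow>
     Ihat \<in> measurable (mat_space p) (count_space UNIV) \<and>
     (\<forall>y\<in>space (mat_space p).
        is_arg_max (\<lambda>I. pi_tilde_idx p \<kappa> \<sigma> y I) (\<lambda>I. I \<in> {0..p}) (Ihat y))"

definition pi_tilde_cond ::
    "nat \<Rightarrow> real \<Rightarrow> (nat \<times> nat \<Rightarrow> real) measure \<Rightarrow> nat \<Rightarrow> (nat \<times> nat \<Rightarrow> real)
      \<Rightarrow> (nat \<times> nat \<Rightarrow> real) set \<Rightarrow> real" where
  "pi_tilde_cond p \<sigma> PZ I y B =
    measure PZ {z \<in> space PZ. (\<lambda>ij\<in>idx p. band_proj p I y ij + \<sigma> * band_proj p I z ij) \<in> B}"

(* Mixed stands for the mixture measure (tilde), Selected for the model selection one (check). *)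
datatype ddm = Mixed | Selected

definition ddm_idx ::
    "ddm \<Rightarrow> nat \<Rightarrow> real \<Rightarrow> real \<Rightarrow> ((nat \<times> nat \<Rightarrow> real) \<Rightarrow> nat) \<Rightarrow> (nat \<times> nat \<Rightarrow> real)
      \<Rightarrow> nat set \<Rightarrow> real" where
  "ddm_idx kind p \<kappa> \<sigma> Ihat y G =
    (case kind of
       Mixed \<Rightarrow> (\<Sum>I\<in>{0..p} \<inter> G. pi_tilde_idx p \<kappa> \<sigma> y I)
     | Selected \<Rightarrow> (\<Sum>I\<in>{0..p} \<inter> G. if I = Ihat y then 1 else 0))"

definition ddm_cov ::
    "ddm \<Rightarrow> nat \<Rightarrow> real \<Rightarrow> real \<Rightarrow> (nat \<times> nat \<Rightarrow> real) measure \<Rightarrow> ((nat \<times> nat \<Rightarrow> real) \<Rightarrow> nat)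
      \<Rightarrow> (nat \<times> nat \<Rightarrow> real) \<Rightarrow> (nat \<times> nat \<Rightarrow> real) set \<Rightarrow> real" where
  "ddm_cov kind p \<kappa> \<sigma> PZ Ihat y B =
    (case kind of
       Mixed \<Rightarrow> (\<Sum>I\<in>{0..p}. pi_tilde_cond p \<sigma> PZ I y B * pi_tilde_idx p \<kappa> \<sigma> y I)
     | Selected \<Rightarrow> pi_tilde_cond p \<sigma> PZ (Ihat y) y B)"

definition ddm_mean ::
    "ddm \<Rightarrow> nat \<Rightarrow> real \<Rightarrow> real \<Rightarrow> ((nat \<times> nat \<Rightarrow> real) \<Rightarrow> nat) \<Rightarrow> (nat \<times> nat \<Rightarrow> real)
      \<Rightarrow> nat \<times> nat \<Rightarrow> real" where
  "ddm_mean kind p \<kappa> \<sigma> Ihat y =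
    (case kind of
       Mixed \<Rightarrow> (\<lambda>ij\<in>idx p. \<Sum>I\<in>{0..p}. band_proj p I y ij * pi_tilde_idx p \<kappa> \<sigma> y I)
     | Selected \<Rightarrow> band_proj p (Ihat y) y)"

definition rhat2 ::
    "nat \<Rightarrow> real \<Rightarrow> ((nat \<times> nat \<Rightarrow> real) \<Rightarrow> nat) \<Rightarrow> (nat \<times> nat \<Rightarrow> real) \<Rightarrow> real" where
  "rhat2 p \<sigma> Ihat y = \<sigma>\<^sup>2 + \<sigma>\<^sup>2 * rho p (Ihat y)"

end

theory Submission
  imports Defs
begin

text \<open>
  Up to an event of probability at most the remainder term, every entry of the sample covariance
  lies within \<open>\<sigma> / sqrt 2\<close> of the true one (Chernoff bounds for squares of Gaussian
  linear forms, and a union bound over the entries); for \<open>\<sigma> = 0\<close> the remainder exceeds 1.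
  Off that event everything is deterministic. Between two bands I and J the noise has squared norm
  at most \<open>\<sigma>\<^sup>2 (\<rho> J - \<rho> I)\<close>, as the difference of the bands has twice as many
  entries as \<open>\<rho> J - \<rho> I\<close>. Hence the log-weights of two bands compare through their biases and
  dimensions alone: bands with a rate far above the oracle rate have exponentially small mass, the
  selected band has a rate of the order of the oracle rate, and it has at least the dimension of
  the \<open>\<tau>\<^sub>0\<close>-oracle. The only other random quantity is Z, which is
  controlled by its exponential moment.
\<close>

section \<open>Concentration of the sample covariance\<close>

text \<open>The entries of the noise are dependent, but the weights compare bands only through sums
  of squares of entries, so control of each single entry is enough and no joint law is needed. The
  price is the factor \<open>p\<^sup>2\<close>, which is the exp(2 log p) of the remainder, while 4
  counts the tails per entry. The threshold \<open>\<sigma> / sqrt 2\<close> makes the noise cost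
  exactly one unit of log-weight per dimension, so it competes directly with the penalty
  \<open>\<kappa>\<close>. It yields the exponent n \<sigma>^2 / 64, better than the required one
  because eigenvalues between \<epsilon> and 1/\<epsilon> force \<epsilon> \<le> 1. On the good
  event \<alpha> enters only through \<alpha> \<le> 1, in the form of
  \<open>\<kappa> \<ge> 8 * \<nu> + 5 / 2\<close>, \<open>c\<^sub>3 \<ge> 6 + 4 * \<kappa>\<close>
  and \<open>\<tau>\<^sub>0 > 3 * \<kappa> + 3\<close>; its actual value matters only for Z. A term
  exponential in M arises from the mass of bad bands and from Z alone. In the three bounds on
  probabilities the event is contained in the bad event, and the summand with M is slack.\<close>

lemma psd_zero_diagonal:
  fixes S :: "nat \<times> nat \<Rightarrow> real"
  assumes sym: "\<And>i j. i < Suc p \<Longrightarrow> j < Suc p \<Longrightarrow> S (i, j) = S (j, i)"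
    and psd: "\<And>u. 0 \<le> (\<Sum>i<Suc p. \<Sum>j<Suc p. u i * S (i, j) * u j)"
    and "S (p, p) = 0" "i < p"
  shows "S (i, p) = 0"
proof (rule ccontr)
  assume nz: "S (i, p) \<noteq> 0"
  \<comment> \<open>With a zero diagonal entry at p the quadratic form at e_i + t e_p is affine in
    t, namely S(i,i) + 2 t S(i,p); this t makes it -1.\<close>
  define t where "t = - (S (i, i) + 1) / (2 * S (i, p))"
  define u :: "nat \<Rightarrow> real" where "u = (\<lambda>k. if k = i then 1 else if k = p then t else 0)"
  have u: "(\<Sum>j<Suc p. f j * u j) = f i + f p * t" for f
    using \<open>i < p\<close> by (simp add: u_def if_distrib[of "\<lambda>x. _ * x"] sum.delta cong: if_cong)
  have "(\<Sum>i<Suc p. \<Sum>j<Suc p. u i * S (i, j) * u j) = (\<Sum>k<Suc p. (S (k, i) + S (k, p) * t) * u k)"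
    by (rule sum.cong[OF refl]) (subst u, simp add: algebra_simps)
  also have "\<dots> = S (i, i) + 2 * t * S (i, p)"
    using sym[of i p] assms(3,4) by (subst u) (simp add: algebra_simps)
  also have "\<dots> = -1"
    using nz by (simp add: t_def field_simps)
  finally show False using psd[of u] by simp
qed

text \<open>Cholesky factorization by induction on p: the Schur complement S' of the last diagonal
  entry a is again positive semidefinite. If a = 0, all quotients by a are 0, and nothing is lost
  because \<open>psd_zero_diagonal\<close> makes the last row and column vanish. Existence of a
  factor is what gives the choice in \<open>mvn\<close> its meaning.\<close>

lemma psd_factorization:
  fixes S :: "nat \<times> nat \<Rightarrow> real"
  assumes "\<And>i j. i < p \<Longrightarrow> j < p \<Longrightarrow> S (i, j) = S (j, i)"
    and "\<And>u. 0 \<le> (\<Sum>i<p. \<Sum>j<p. u i * S (i, j) * u j)"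
  shows "\<exists>A :: nat \<Rightarrow> nat \<Rightarrow> real. \<forall>i<p. \<forall>j<p. (\<Sum>k<p. A i k * A j k) = S (i, j)"
  using assms
proof (induction p arbitrary: S)
  case 0
  then show ?case by simp
next
  case (Suc p)
  note sym = Suc.prems(1) and psd = Suc.prems(2)
  define a where "a = S (p, p)"
  define S' where "S' = (\<lambda>(i, j). S (i, j) - S (i, p) * S (j, p) / a)"
  have a: "a \<ge> 0"
    using psd[of "\<lambda>k. if k = p then 1 else 0"] by (simp add: a_def)
  have az: "S (i, p) = 0" if "a = 0" "i < p" for i
    using psd_zero_diagonal[OF sym psd] that by (simp add: a_def)
  have "\<exists>A' :: nat \<Rightarrow> nat \<Rightarrow> real. \<forall>i<p. \<forall>j<p. (\<Sum>k<p. A' i k * A' j k) = S' (i, j)"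
  proof (rule Suc.IH)
    fix i j assume "i < p" "j < p"
    then show "S' (i, j) = S' (j, i)" using sym[of i j] by (simp add: S'_def mult.commute)
  next
    fix u :: "nat \<Rightarrow> real"
    define b where "b = (\<Sum>i<p. u i * S (i, p))"
    \<comment> \<open>For a > 0 this last coordinate minimizes the quadratic form when the others
      are fixed to u; the minimum is the form of the Schur complement at u. For a = 0 it is
      0.\<close>
    define w where "w = u(p := - b / a)"
    have b': "(\<Sum>i<p. S (p, i) * u i) = b"
      unfolding b_def by (rule sum.cong) (auto simp: sym[of _ p])
    have w: "w i = u i" if "i < p" for i using that by (simp add: w_def)
    have "(\<Sum>i<Suc p. \<Sum>j<Suc p. w i * S (i, j) * w j) =
        (\<Sum>i<p. \<Sum>j<p. w i * S (i, j) * w j) + (\<Sum>i<p. w i * S (i, p)) * w p +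
        (w p * (\<Sum>i<p. S (p, i) * w i) + w p * a * w p)"
      by (simp add: sum.distrib a_def sum_distrib_left sum_distrib_right mult.assoc)
    also have "\<dots> = (\<Sum>i<p. \<Sum>j<p. u i * S (i, j) * u j) + 2 * b * w p + w p * a * w p"
      by (simp add: w b' b_def[symmetric])
    also have "\<dots> = (\<Sum>i<p. \<Sum>j<p. u i * S (i, j) * u j) - b * b / a"
      by (cases "a = 0") (auto simp: w_def field_simps)
    also have "b * b / a = (\<Sum>i<p. \<Sum>j<p. u i * (S (i, p) * S (j, p) / a) * u j)"
      unfolding b_def sum_product sum_divide_distrib by (intro sum.cong) auto
    also have "(\<Sum>i<p. \<Sum>j<p. u i * S (i, j) * u j) - \<dots> = (\<Sum>i<p. \<Sum>j<p. u i * S' (i, j) * u j)"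
      unfolding S'_def sum_subtractf[symmetric] by (intro sum.cong refl) (simp add: algebra_simps)
    finally show "0 \<le> (\<Sum>i<p. \<Sum>j<p. u i * S' (i, j) * u j)" using psd[of w] by simp
  qed
  then obtain A' :: "nat \<Rightarrow> nat \<Rightarrow> real"
    where A': "\<And>i j. i < p \<Longrightarrow> j < p \<Longrightarrow> (\<Sum>k<p. A' i k * A' j k) = S' (i, j)" by blast
  \<comment> \<open>The factor of the Schur complement, bordered by the last column of S divided by
    sqrt a; row p is zero except for its last entry.\<close>
  define A where "A = (\<lambda>i k. if k = p then S (i, p) / sqrt a else if i = p then 0 else A' i k)"
  have "(\<Sum>k<Suc p. A i k * A j k) = S (i, j)" if "i < Suc p" "j < Suc p" for i j
  proof -
    have last: "A i p * A j p = S (i, p) * S (j, p) / a"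
      using a by (simp add: A_def)
    have aa: "S (i, p) * a / a = S (i, p)" if "i < Suc p" for i
      using az[of i] that by (cases "a = 0"; cases "i = p") (auto simp: a_def)
    show ?thesis
    proof (cases "i < p \<and> j < p")
      case True
      then have "(\<Sum>k<p. A i k * A j k) = S' (i, j)"
        using A'[of i j] by (simp add: A_def)
      then show ?thesis using last by (simp add: S'_def)
    next
      case False
      then have "i = p \<or> j = p" using that by auto
      moreover from this have "(\<Sum>k<p. A i k * A j k) = 0"
        by (intro sum.neutral) (auto simp: A_def)
      ultimately show ?thesis
        using last aa[OF that(1)] aa[OF that(2)] sym[OF that] by (auto simp: a_def[symmetric] mult.commute)
    qed
  qed
  then show ?case by blast
qed

text \<open>Opens the choice operator in \<open>mvn\<close>. Of the chosen factor, only its product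
  with its transpose is used afterwards.\<close>

lemma covariance_mat_factor:
  assumes "covariance_mat p S"
  obtains A where "\<And>i j. i < p \<Longrightarrow> j < p \<Longrightarrow> (\<Sum>k<p. A $$ (i, k) * A $$ (j, k)) = S (i, j)"
    and "mvn p S = distr (std_normal_vec p) (Pi\<^sub>M {..<p} (\<lambda>_. borel))
          (\<lambda>z. \<lambda>j\<in>{..<p}. \<Sum>k<p. A $$ (j, k) * z k)"
proof -
  let ?P = "\<lambda>A. A \<in> carrier_mat p p \<and> A * transpose_mat A = Matrix.mat p p S"
  define A where "A = (SOME A. ?P A)"
  obtain B :: "nat \<Rightarrow> nat \<Rightarrow> real"
    where B: "\<And>i j. i < p \<Longrightarrow> j < p \<Longrightarrow> (\<Sum>k<p. B i k * B j k) = S (i, j)"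
    using psd_factorization[of p S] assms unfolding covariance_mat_def by blast
  have "?P (Matrix.mat p p (\<lambda>(i, k). B i k))"
    by (auto intro!: eq_matI simp: scalar_prod_def atLeast0LessThan B)
  then have A: "?P A" unfolding A_def by (rule someI)
  have dims: "dim_row A = p" "dim_col A = p" using A by auto
  have "(\<Sum>k<p. A $$ (i, k) * A $$ (j, k)) = S (i, j)" if "i < p" "j < p" for i j
  proof -
    have "S (i, j) = (A * transpose_mat A) $$ (i, j)" using A that by simp
    also have "\<dots> = (\<Sum>k<p. A $$ (i, k) * A $$ (j, k))"
      using dims that by (simp add: scalar_prod_def atLeast0LessThan)
    finally show ?thesis by simp
  qed
  moreover have "mvn p S = distr (std_normal_vec p) (Pi\<^sub>M {..<p} (\<lambda>_. borel))
          (\<lambda>z. \<lambda>j\<in>{..<p}. \<Sum>k<p. A $$ (j, k) * z k)"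
    by (simp add: mvn_def A_def Let_def)
  ultimately show ?thesis using A that by blast
qed

section \<open>Linear forms of Gaussian vectors\<close>

lemma sets_std_normal_vec: "sets (std_normal_vec p) = sets (Pi\<^sub>M {..<p} (\<lambda>_. borel))"
  by (auto simp: std_normal_vec_def intro!: sets_PiM_cong)

lemma prob_space_std_normal_vec: "prob_space (std_normal_vec p)"
  unfolding std_normal_vec_def by (intro prob_space_PiM prob_space_normal_density) simp

lemma measurable_std_normal_linear [measurable]:
  "(\<lambda>z. \<Sum>k<p. b k * z k) \<in> borel_measurable (std_normal_vec p)"
proof -
  have "(\<lambda>z. \<Sum>k<p. b k * z k) \<in> borel_measurable (Pi\<^sub>M {..<p} (\<lambda>_. borel))" by measurable
  then show ?thesis by (simp cong: measurable_cong_sets add: sets_std_normal_vec)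
qed

lemma std_normal_vec_component:
  assumes "k < p"
  shows "distr (std_normal_vec p) borel (\<lambda>z. z k) = density lborel (\<lambda>x. ennreal (std_normal_density x))"
    (is "_ = ?N")
proof -
  have "distr (std_normal_vec p) borel (\<lambda>z. z k) = distr (std_normal_vec p) ?N (\<lambda>z. z k)"
    by (rule distr_cong) auto
  also have "\<dots> = ?N"
    unfolding std_normal_vec_def
    by (rule distr_PiM_component[where M = "\<lambda>_. ?N"]) (use assms in \<open>auto intro: prob_space_normal_density\<close>)
  finally show ?thesis .
qed

text \<open>The joint law of the coordinates is the product of their marginals, which characterizes
  independence over a nonempty index set; \<open>p = 0\<close> is read off the definition.\<close>

lemma indep_vars_std_normal_vec:
  "prob_space.indep_vars (std_normal_vec p) (\<lambda>_. borel) (\<lambda>k z. z k) {..<p}"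
proof (cases "p = 0")
  case True
  interpret prob_space "std_normal_vec p" by (rule prob_space_std_normal_vec)
  show ?thesis unfolding indep_vars_def indep_sets_def using True by auto
next
  case False
  interpret prob_space "std_normal_vec p" by (rule prob_space_std_normal_vec)
  have meas: "random_variable borel (\<lambda>z. z k)" if "k \<in> {..<p}" for k
  proof -
    have "(\<lambda>z. z k) \<in> borel_measurable (Pi\<^sub>M {..<p} (\<lambda>_. borel))" using that by measurable
    then show ?thesis by (simp cong: measurable_cong_sets add: sets_std_normal_vec)
  qed
  have "distr (std_normal_vec p) (Pi\<^sub>M {..<p} (\<lambda>_. borel)) (\<lambda>z. \<lambda>k\<in>{..<p}. z k) =
      distr (std_normal_vec p) (std_normal_vec p) (\<lambda>z. z)"
    by (rule distr_cong[OF refl sets_std_normal_vec[symmetric]])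
      (auto simp: std_normal_vec_def space_PiM PiE_def extensional_def restrict_def)
  also have "\<dots> = std_normal_vec p" by (rule distr_id)
  also have "\<dots> = (\<Pi>\<^sub>M k\<in>{..<p}. distr (std_normal_vec p) borel (\<lambda>z. z k))"
    by (subst std_normal_vec_def, rule PiM_cong) (auto simp: std_normal_vec_component)
  finally show ?thesis
    using False by (subst indep_vars_iff_distr_eq_PiM') (auto intro!: meas simp: lessThan_empty_iff)
qed

lemma std_normal_vec_linear:
  assumes "(\<Sum>k<p. (b k)\<^sup>2) = v" "v > 0"
  shows "distributed (std_normal_vec p) lborel (\<lambda>z. \<Sum>k<p. b k * z k) (normal_density 0 (sqrt v))"
proof -
  interpret prob_space "std_normal_vec p" by (rule prob_space_std_normal_vec)
  \<comment> \<open>A summand with zero coefficient has no density, so the sum of independent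
    normals is formed over the nonzero coefficients only; v > 0 ensures that there are some.\<close>
  define I where "I = {k \<in> {..<p}. b k \<noteq> 0}"
  have sumI: "(\<Sum>k<p. f k) = (\<Sum>k\<in>I. f k)" if "\<And>k. b k = 0 \<Longrightarrow> f k = 0" for f :: "nat \<Rightarrow> real"
    unfolding I_def using that by (intro sum.mono_neutral_right) auto
  have v: "(\<Sum>k\<in>I. \<bar>b k\<bar>\<^sup>2) = v"
    using assms(1) sumI[of "\<lambda>k. (b k)\<^sup>2"] by simp
  have ne: "I \<noteq> {}" using v \<open>v > 0\<close> by auto
  have "indep_vars (\<lambda>_. borel) (\<lambda>k z. b k * z k) {..<p}"
    by (rule indep_vars_compose2[OF indep_vars_std_normal_vec]) auto
  then have ind: "indep_vars (\<lambda>_. borel) (\<lambda>k z. b k * z k) I"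
    by (rule indep_vars_subset) (auto simp: I_def)
  have "distributed (std_normal_vec p) lborel (\<lambda>z. b k * z k) (normal_density 0 \<bar>b k\<bar>)"
    if "k \<in> I" for k
  proof -
    have k: "k < p" "b k \<noteq> 0" using that by (auto simp: I_def)
    have "random_variable borel (\<lambda>z. z k)"
      using indep_vars_std_normal_vec[of p] k by (auto simp: indep_vars_def)
    moreover have "distr (std_normal_vec p) lborel (\<lambda>z. z k) = density lborel (\<lambda>x. ennreal (std_normal_density x))"
      using std_normal_vec_component[OF k(1)] by (metis distr_cong sets_lborel)
    ultimately have "distributed (std_normal_vec p) lborel (\<lambda>z. z k) (normal_density 0 1)"
      by (simp add: distributed_def)
    from normal_density_affine[OF this, of "b k" 0] k show ?thesis by simp
  qed
  then have "distributed (std_normal_vec p) lborel (\<lambda>z. \<Sum>k\<in>I. b k * z k)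
      (normal_density (\<Sum>k\<in>I. 0) (sqrt (\<Sum>k\<in>I. \<bar>b k\<bar>\<^sup>2)))"
    by (intro sum_indep_normal ind ne) (auto simp: I_def)
  then have "distributed (std_normal_vec p) lborel (\<lambda>z. \<Sum>k\<in>I. b k * z k) (normal_density 0 (sqrt v))"
    by (simp only: v sum.neutral_const)
  then show ?thesis by (simp add: sumI)
qed

lemma sets_mvn [measurable_cong]: "sets (mvn p S) = sets (Pi\<^sub>M {..<p} (\<lambda>_. borel))"
  by (simp add: mvn_def Let_def)

lemma measurable_mvn_map:
  "(\<lambda>z. \<lambda>j\<in>{..<p}. \<Sum>k<p. A j k * z k) \<in> measurable (std_normal_vec p) (Pi\<^sub>M {..<p} (\<lambda>_. borel))"
  by (rule measurable_restrict) measurable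

lemma prob_space_mvn: "prob_space (mvn p S)"
  unfolding mvn_def Let_def
  by (rule prob_space.prob_space_distr[OF prob_space_std_normal_vec measurable_mvn_map])

text \<open>With x = A z the form a.x equals b.z for b = A^T a, and |b|^2 = a^T S a. The variance 0
  is treated apart because the form then has no density.\<close>

lemma mvn_linear:
  assumes S: "covariance_mat p S"
    and v: "v = (\<Sum>i<p. \<Sum>j<p. a i * S (i, j) * a j)"
  shows "v > 0 \<Longrightarrow> distributed (mvn p S) lborel (\<lambda>x. \<Sum>j<p. a j * x j) (normal_density 0 (sqrt v))"
    and "v = 0 \<Longrightarrow> AE x in mvn p S. (\<Sum>j<p. a j * x j) = 0"
proof -
  obtain A where A: "\<And>i j. i < p \<Longrightarrow> j < p \<Longrightarrow> (\<Sum>k<p. A $$ (i, k) * A $$ (j, k)) = S (i, j)"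
    and mvn: "mvn p S = distr (std_normal_vec p) (Pi\<^sub>M {..<p} (\<lambda>_. borel))
          (\<lambda>z. \<lambda>j\<in>{..<p}. \<Sum>k<p. A $$ (j, k) * z k)" (is "_ = distr _ _ ?f")
    by (rule covariance_mat_factor[OF S]) (rule that)
  define b where "b = (\<lambda>k. \<Sum>j<p. a j * A $$ (j, k))"
  have bv: "(\<Sum>k<p. (b k)\<^sup>2) = v"
  proof -
    have "(\<Sum>k<p. (b k)\<^sup>2) = (\<Sum>k<p. \<Sum>i<p. \<Sum>j<p. a i * (A $$ (i, k) * A $$ (j, k)) * a j)"
      unfolding b_def power2_eq_square sum_product by (intro sum.cong refl) simp
    also have "\<dots> = (\<Sum>i<p. \<Sum>j<p. \<Sum>k<p. a i * (A $$ (i, k) * A $$ (j, k)) * a j)"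
      by (subst sum.swap) (intro sum.cong refl sum.swap)
    also have "\<dots> = v"
      unfolding v by (intro sum.cong refl) (simp add: A[symmetric] sum_distrib_left sum_distrib_right)
    finally show ?thesis .
  qed
  have lin: "(\<Sum>j<p. a j * (\<Sum>k<p. A $$ (j, k) * z k)) = (\<Sum>k<p. b k * z k)" for z
    unfolding b_def
    by (simp add: sum_distrib_left sum_distrib_right mult.assoc) (rule sum.swap)
  have meas [measurable]: "?f \<in> measurable (std_normal_vec p) (Pi\<^sub>M {..<p} (\<lambda>_. borel))"
    by (rule measurable_mvn_map)
  have meas_lin [measurable]: "(\<lambda>x. \<Sum>j<p. a j * x j) \<in> borel_measurable (Pi\<^sub>M {..<p} (\<lambda>_. borel))"
    by measurable
  {
    assume "v > 0"
    from std_normal_vec_linear[OF bv this]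
    have D: "distr (std_normal_vec p) lborel (\<lambda>z. \<Sum>k<p. b k * z k) = density lborel (normal_density 0 (sqrt v))"
      by (simp add: distributed_def)
    have "distr (mvn p S) lborel (\<lambda>x. \<Sum>j<p. a j * x j) =
        distr (std_normal_vec p) lborel (\<lambda>z. \<Sum>k<p. b k * z k)"
      unfolding mvn by (subst distr_distr) (auto simp: comp_def lin)
    then show "distributed (mvn p S) lborel (\<lambda>x. \<Sum>j<p. a j * x j) (normal_density 0 (sqrt v))"
      unfolding distributed_def D
      by (simp add: measurable_cong_sets[OF sets_mvn])
  next
    assume "v = 0"
    then have "b k = 0" if "k < p" for k
      using bv that by (simp add: sum_nonneg_eq_0_iff)
    then have "\<And>z. (\<Sum>j<p. a j * ?f z j) = 0" by (simp add: lin)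
    then show "AE x in mvn p S. (\<Sum>j<p. a j * x j) = 0"
      unfolding mvn by (subst AE_distr_iff) auto
  }
qed

section \<open>Exponential moments of squared Gaussian linear forms\<close>

lemma ln_one_minus_lower_bound:
  fixes w :: real
  assumes "\<bar>w\<bar> \<le> 1 / 2"
  shows "- w - w\<^sup>2 \<le> ln (1 - w)"
proof (cases "w \<ge> 0")
  case False
  then show ?thesis using ln_one_plus_pos_lower_bound[of "- w"] assms by simp
next
  case True
  \<comment> \<open>With u = w + w^2, the excess of (1 - w)(1 + u + u^2/2) over 1 is w^2/2 times the
    polynomial below; this grouping shows its sign for 0 \<le> w \<le> 1/2. The exponential then
    dominates its quadratic Taylor polynomial.\<close>
  have "0 \<le> (1 + w) * (1 - 2 * w) + w\<^sup>2 * (1 - w)"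
    using True assms by (intro add_nonneg_nonneg mult_nonneg_nonneg) auto
  also have "\<dots> = 1 - w - w\<^sup>2 - w ^ 3"
    by (simp add: algebra_simps power2_eq_square power3_eq_cube)
  finally have "0 \<le> w\<^sup>2 * (1 - w - w\<^sup>2 - w ^ 3) / 2" by simp
  also have "\<dots> = (1 - w) * (1 + (w + w\<^sup>2) + (w + w\<^sup>2)\<^sup>2 / 2) - 1"
    by (simp add: field_simps power2_eq_square power3_eq_cube)
  finally have "1 \<le> (1 - w) * (1 + (w + w\<^sup>2) + (w + w\<^sup>2)\<^sup>2 / 2)" by simp
  also have "\<dots> \<le> (1 - w) * exp (w + w\<^sup>2)"
    using True assms by (intro mult_left_mono exp_lower_Taylor_quadratic) auto
  finally have "0 \<le> ln ((1 - w) * exp (w + w\<^sup>2))"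
    by (intro ln_ge_zero)
  also have "\<dots> = ln (1 - w) + (w + w\<^sup>2)"
    using assms by (subst ln_mult) auto
  finally show ?thesis by simp
qed

text \<open>Tilting: the integrand is the constant on the right times the centred normal density
  with variance w, where 1/w = 1/v - 2s.\<close>

lemma nn_integral_normal_exp_square:
  assumes v: "v > 0" and s: "2 * s * v < 1"
  shows "(\<integral>\<^sup>+ x. ennreal (normal_density 0 (sqrt v) x) * ennreal (exp (s * x\<^sup>2)) \<partial>lborel) =
    ennreal (1 / sqrt (1 - 2 * s * v))"
proof -
  define w where "w = v / (1 - 2 * s * v)"
  have w: "w > 0" using v s by (simp add: w_def)
  have eq: "normal_density 0 (sqrt v) x * exp (s * x\<^sup>2) =
      1 / sqrt (1 - 2 * s * v) * normal_density 0 (sqrt w) x" for x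
  proof -
    have e: "- (x\<^sup>2 / (2 * v)) + s * x\<^sup>2 = - (x\<^sup>2 / (2 * w))"
      using v s by (simp add: w_def field_simps)
    have "sqrt (2 * pi * w) * sqrt (1 - 2 * s * v) = sqrt (2 * pi * v)"
      using s by (simp add: real_sqrt_mult[symmetric] w_def)
    moreover have "sqrt (1 - 2 * s * v) > 0" "sqrt (2 * pi * w) > 0" "sqrt (2 * pi * v) > 0"
      using s v w by auto
    ultimately have "1 / sqrt (2 * pi * v) = 1 / sqrt (1 - 2 * s * v) * (1 / sqrt (2 * pi * w))"
      by (metis mult.commute mult_1 times_divide_times_eq)
    then have f: "1 / sqrt (2 * pi * v) * y = 1 / sqrt (1 - 2 * s * v) * (1 / sqrt (2 * pi * w) * y)" for y
      by (simp only: mult.assoc)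
    have "normal_density 0 (sqrt v) x * exp (s * x\<^sup>2) =
        1 / sqrt (2 * pi * v) * exp (- (x\<^sup>2 / (2 * v)) + s * x\<^sup>2)"
      using v by (simp add: normal_density_def exp_add[symmetric])
    also have "\<dots> = 1 / sqrt (1 - 2 * s * v) * (1 / sqrt (2 * pi * w) * exp (- (x\<^sup>2 / (2 * w))))"
      by (simp only: e f)
    also have "\<dots> = 1 / sqrt (1 - 2 * s * v) * normal_density 0 (sqrt w) x"
      using w by (simp add: normal_density_def)
    finally show ?thesis .
  qed
  have "(\<integral>\<^sup>+ x. ennreal (normal_density 0 (sqrt v) x) * ennreal (exp (s * x\<^sup>2)) \<partial>lborel) =
      (\<integral>\<^sup>+ x. ennreal (1 / sqrt (1 - 2 * s * v)) * ennreal (normal_density 0 (sqrt w) x) \<partial>lborel)"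
    using s by (intro nn_integral_cong) (simp add: ennreal_mult[symmetric] eq)
  also have "\<dots> = ennreal (1 / sqrt (1 - 2 * s * v)) * (\<integral>\<^sup>+ x. ennreal (normal_density 0 (sqrt w) x) \<partial>lborel)"
    by (rule nn_integral_cmult) auto
  also have "(\<integral>\<^sup>+ x. ennreal (normal_density 0 (sqrt w) x) \<partial>lborel) = 1"
    using w prob_space.emeasure_space_1[OF prob_space_normal_density[of "sqrt w" 0]]
    by (simp add: emeasure_density)
  finally show ?thesis by simp
qed

text \<open>For v > 0 the logarithm of the left side is -sv - ln(1 - 2sv)/2, and
  \<open>ln_one_minus_lower_bound\<close> at 2sv bounds it by 2(sv)^2. The condition on s v is the
  range of that lemma.\<close>

lemma mvn_quadratic_mgf:
  assumes S: "covariance_mat p S"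
    and v: "v = (\<Sum>i<p. \<Sum>j<p. a i * S (i, j) * a j)"
    and s: "\<bar>s * v\<bar> \<le> 1 / 4"
  shows "(\<integral>\<^sup>+ x. ennreal (exp (s * ((\<Sum>j<p. a j * x j)\<^sup>2 - v))) \<partial>mvn p S) \<le> ennreal (exp (2 * (s * v)\<^sup>2))"
proof -
  interpret prob_space "mvn p S" by (rule prob_space_mvn)
  have "v \<ge> 0" using S unfolding covariance_mat_def v by blast
  then consider "v = 0" | "v > 0" by linarith
  then show ?thesis
  proof cases
    case 1
    have "(\<integral>\<^sup>+ x. ennreal (exp (s * ((\<Sum>j<p. a j * x j)\<^sup>2 - v))) \<partial>mvn p S) = (\<integral>\<^sup>+ x. 1 \<partial>mvn p S)"
      using mvn_linear(2)[OF S v 1] 1 by (intro nn_integral_cong_AE) auto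
    then show ?thesis using 1 by (simp add: emeasure_space_1)
  next
    case 2
    have sv: "2 * s * v < 1" using s by (simp add: abs_le_iff)
    have "(\<integral>\<^sup>+ x. ennreal (exp (s * ((\<Sum>j<p. a j * x j)\<^sup>2 - v))) \<partial>mvn p S) =
        (\<integral>\<^sup>+ x. ennreal (normal_density 0 (sqrt v) x) * ennreal (exp (s * (x\<^sup>2 - v))) \<partial>lborel)"
      by (rule distributed_nn_integral[OF mvn_linear(1)[OF S v 2], symmetric]) measurable
    also have "\<dots> = (\<integral>\<^sup>+ x. ennreal (exp (- (s * v))) *
        (ennreal (normal_density 0 (sqrt v) x) * ennreal (exp (s * x\<^sup>2))) \<partial>lborel)"
      by (intro nn_integral_cong)
        (simp add: ennreal_mult[symmetric] right_diff_distrib exp_diff exp_minus field_simps)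
    also have "\<dots> = ennreal (exp (- (s * v))) * ennreal (1 / sqrt (1 - 2 * s * v))"
      by (subst nn_integral_cmult) (auto simp: nn_integral_normal_exp_square[OF 2 sv])
    also have "\<dots> = ennreal (exp (- (s * v) - ln (1 - 2 * s * v) / 2))"
      using sv by (simp add: ennreal_mult[symmetric] exp_diff ln_sqrt[symmetric] divide_simps)
    also have "\<dots> \<le> ennreal (exp (2 * (s * v)\<^sup>2))"
      using ln_one_minus_lower_bound[of "2 * s * v"] s
      by (intro ennreal_leI) (simp add: power2_eq_square abs_mult mult.assoc)
    finally show ?thesis .
  qed
qed

text \<open>The fourth moment of N(0,v) is 3 v^2, which exceeds 1 as soon as v > 1.\<close>

lemma moment_class_diag_le_1:
  assumes S: "covariance_mat p S" and m: "S \<in> moment_class p" and "j < p"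
  shows "S (j, j) \<le> 1"
proof (rule ccontr)
  define a :: "nat \<Rightarrow> real" where "a = (\<lambda>k. if k = j then 1 else 0)"
  define v where "v = S (j, j)"
  assume "\<not> S (j, j) \<le> 1"
  then have v1: "v > 1" by (simp add: v_def)
  then have v0: "v > 0" by simp
  have a: "(\<Sum>k<p. a k * f k) = f j" for f :: "nat \<Rightarrow> real"
    using \<open>j < p\<close> by (simp add: a_def if_distrib[of "\<lambda>x. x * _"] cong: if_cong)
  have a': "(\<Sum>k<p. f k * a k) = f j" for f :: "nat \<Rightarrow> real"
    using a[of f] by (simp add: mult.commute)
  have v: "v = (\<Sum>i<p. \<Sum>k<p. a i * S (i, k) * a k)"
    unfolding a' by (simp add: a v_def)
  have "distributed (mvn p S) lborel (\<lambda>x. x j) (normal_density 0 (sqrt v))"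
    using mvn_linear(1)[OF S v v0] unfolding a .
  then have "(\<integral>\<^sup>+ x. ennreal (x j ^ 4) \<partial>mvn p S) =
      (\<integral>\<^sup>+ x. ennreal (normal_density 0 (sqrt v) x) * ennreal (x ^ 4) \<partial>lborel)"
    by (intro distributed_nn_integral[symmetric]) measurable
  also have "\<dots> = (\<integral>\<^sup>+ x. ennreal (normal_density 0 (sqrt v) x * (x - 0) ^ (2 * 2)) \<partial>lborel)"
    by (simp add: ennreal_mult)
  also have "\<dots> = ennreal (fact (2 * 2) / ((2 / (sqrt v)\<^sup>2) ^ 2 * fact 2))"
  proof -
    have "has_bochner_integral lborel (\<lambda>x. normal_density 0 (sqrt v) x * (x - 0) ^ (2 * 2))
        (fact (2 * 2) / ((2 / (sqrt v)\<^sup>2) ^ 2 * fact 2))"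
      using v0 by (intro normal_moment_even) simp
    then show ?thesis
      by (auto simp: has_bochner_integral_iff intro!: nn_integral_eq_integral[THEN trans])
  qed
  also have "fact (2 * 2) / ((2 / (sqrt v)\<^sup>2) ^ 2 * fact 2) = 3 * v\<^sup>2"
    using v0 by (simp add: fact_numeral field_simps)
  finally have "(\<integral>\<^sup>+ x. ennreal (x j ^ 4) \<partial>mvn p S) = ennreal (3 * v\<^sup>2)" .
  moreover have "(\<integral>\<^sup>+ x. ennreal (x j ^ 4) \<partial>mvn p S) \<le> 1"
    using m \<open>j < p\<close> by (simp add: moment_class_def)
  ultimately have "ennreal (3 * v\<^sup>2) \<le> 1" by metis
  then have "3 * v\<^sup>2 \<le> 1" by simp
  moreover have "v\<^sup>2 > 1" using v1 by (simp add: one_less_power)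
  ultimately show False by simp
qed

section \<open>Chernoff bounds for the entries of the sample covariance\<close>

lemma prob_space_sample_law: "prob_space (sample_law n p S)"
  unfolding sample_law_def by (intro prob_space_PiM prob_space_mvn)

lemma measurable_mvn_linear: "(\<lambda>x. \<Sum>j<p. a j * x j) \<in> borel_measurable (mvn p S)"
  unfolding measurable_cong_sets[OF sets_mvn refl] by measurable

lemma measurable_sample_entry [measurable]:
  assumes "l < n" "i < p"
  shows "(\<lambda>X. X l i) \<in> borel_measurable (sample_law n p S)"
proof -
  have 1: "(\<lambda>X. X l) \<in> measurable (sample_law n p S) (mvn p S)"
    unfolding sample_law_def using assms by (intro measurable_component_singleton) simp
  have 2: "(\<lambda>x. x i) \<in> borel_measurable (mvn p S)"
    using assms measurable_component_singleton[of i "{..<p}" "\<lambda>_. borel :: real measure"]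
    by (simp add: measurable_cong_sets[OF sets_mvn])
  show ?thesis using measurable_compose[OF 1 2] .
qed

text \<open>Markov's inequality for the exponential, whose expectation factorizes over the
  observations. The sign of s selects the tail, so both tails are covered.\<close>

lemma sample_quadratic_tail:
  assumes S: "covariance_mat p S"
    and v: "v = (\<Sum>i<p. \<Sum>j<p. a i * S (i, j) * a j)"
    and s: "\<bar>s * v\<bar> \<le> 1 / 4"
  shows "emeasure (sample_law n p S)
      {X \<in> space (sample_law n p S). s * (\<Sum>l<n. (\<Sum>j<p. a j * X l j)\<^sup>2 - v) \<ge> c}
    \<le> ennreal (exp (real n * (2 * (s * v)\<^sup>2) - c))" (is "emeasure ?P ?E \<le> _")
proof -
  let ?q = "\<lambda>x. s * ((\<Sum>j<p. a j * x j)\<^sup>2 - v)"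
  interpret product_sigma_finite "\<lambda>_. mvn p S"
    by (simp add: product_sigma_finite_def prob_space_imp_sigma_finite prob_space_mvn)
  have "emeasure ?P ?E = (\<integral>\<^sup>+ X. indicator ?E X \<partial>?P)"
    by (rule nn_integral_indicator[symmetric]) measurable
  also have "\<dots> \<le> (\<integral>\<^sup>+ X. ennreal (exp (- c)) * (\<Prod>l<n. ennreal (exp (?q (X l)))) \<partial>?P)"
  proof (rule nn_integral_mono)
    fix X
    have "(\<Prod>l<n. ennreal (exp (?q (X l)))) = ennreal (exp (\<Sum>l<n. ?q (X l)))"
      by (simp add: prod_ennreal exp_sum)
    then have "ennreal (exp (- c)) * (\<Prod>l<n. ennreal (exp (?q (X l)))) =
        ennreal (exp (s * (\<Sum>l<n. (\<Sum>j<p. a j * X l j)\<^sup>2 - v) - c))"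
      by (simp add: ennreal_mult[symmetric] exp_add[symmetric] sum_distrib_left)
    then show "indicator ?E X \<le> ennreal (exp (- c)) * (\<Prod>l<n. ennreal (exp (?q (X l))))"
      by (auto split: split_indicator)
  qed
  also have "\<dots> = ennreal (exp (- c)) * (\<Prod>l<n. \<integral>\<^sup>+ x. ennreal (exp (?q x)) \<partial>mvn p S)"
  proof -
    have "(\<lambda>x. ennreal (exp (?q x))) \<in> borel_measurable (mvn p S)"
      by (rule measurable_compose[OF measurable_mvn_linear, where g = "\<lambda>y. ennreal (exp (s * (y\<^sup>2 - v)))"])
        measurable
    then have "(\<integral>\<^sup>+ X. (\<Prod>l<n. ennreal (exp (?q (X l)))) \<partial>?P) =
        (\<Prod>l<n. \<integral>\<^sup>+ x. ennreal (exp (?q x)) \<partial>mvn p S)"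
      unfolding sample_law_def by (intro product_nn_integral_prod) simp_all
    moreover have "(\<lambda>X. \<Prod>l<n. ennreal (exp (?q (X l)))) \<in> borel_measurable ?P" by measurable
    ultimately show ?thesis by (simp add: nn_integral_cmult)
  qed
  also have "\<dots> \<le> ennreal (exp (- c)) * (\<Prod>l<n. ennreal (exp (2 * (s * v)\<^sup>2)))"
    by (intro mult_left_mono prod_mono_ennreal mvn_quadratic_mgf[OF S v s]) auto
  also have "\<dots> = ennreal (exp (real n * (2 * (s * v)\<^sup>2) - c))"
    by (simp add: ennreal_power ennreal_mult[symmetric] exp_of_nat_mult[symmetric] exp_add[symmetric])
  finally show ?thesis .
qed

text \<open>For e = 1 or e = -1 the quantity is the variance of X^i + e X^j, hence nonnegative. The
  values for e and -e add up to 2 (S(i,i) + S(j,j)) \<le> 4, which bounds each from above.\<close>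

lemma covariance_entry_bound:
  assumes S: "covariance_mat p S" and ij: "i < p" "j < p"
    and "S (i, i) \<le> 1" "S (j, j) \<le> 1" and e: "\<bar>e\<bar> = 1"
  shows "S (i, i) + S (j, j) + 2 * e * S (i, j) \<in> {0..4}"
proof -
  have q: "0 \<le> S (i, i) + S (j, j) + 2 * e * S (i, j)" if "\<bar>e\<bar> = 1" for e :: real
  proof -
    \<comment> \<open>A sum of two indicators rather than a case distinction, so that i = j is
      included.\<close>
    define u :: "nat \<Rightarrow> real" where "u = (\<lambda>k. (if k = i then 1 else 0) + (if k = j then e else 0))"
    have u: "(\<Sum>k<p. f k * u k) = f i + e * f j" for f :: "nat \<Rightarrow> real"
      using ij by (simp add: u_def distrib_left sum.distrib if_distrib[of "\<lambda>x. _ * x"] cong: if_cong)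
    have "(\<Sum>k<p. \<Sum>l<p. u k * S (k, l) * u l) = (\<Sum>k<p. (S (k, i) + e * S (k, j)) * u k)"
      by (rule sum.cong[OF refl]) (subst u, simp add: algebra_simps)
    also have "\<dots> = S (i, i) + e * e * S (j, j) + 2 * e * S (i, j)"
      using S ij by (subst u) (simp add: covariance_mat_def algebra_simps)
    also have "e * e = 1" using that by (metis abs_mult_self_eq mult_1)
    finally have "(\<Sum>k<p. \<Sum>l<p. u k * S (k, l) * u l) = S (i, i) + S (j, j) + 2 * e * S (i, j)"
      by simp
    moreover have "0 \<le> (\<Sum>k<p. \<Sum>l<p. u k * S (k, l) * u l)"
      using S by (simp add: covariance_mat_def)
    ultimately show ?thesis by simp
  qed
  show ?thesis using q[OF e] q[of "- e"] e assms(4,5) by auto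
qed

text \<open>Polarisation, 4xy = (x + y)^2 - (x - y)^2, reduces an entry of the sample
  covariance to two sums of squares; each has two tails, which gives the factor 4.\<close>

lemma sample_cov_entry_tail:
  assumes S: "covariance_mat p S" and ij: "i < p" "j < p"
    and d: "S (i, i) \<le> 1" "S (j, j) \<le> 1" and n: "n \<ge> 1" and t: "0 \<le> t" "t \<le> 1"
  shows "emeasure (sample_law n p S)
      {X \<in> space (sample_law n p S). \<bar>sample_cov n p X (i, j) - S (i, j)\<bar> > t}
    \<le> ennreal (4 * exp (- (real n * t\<^sup>2 / 32)))" (is "emeasure ?P ?E \<le> _")
proof -
  define v where "v = (\<lambda>e. S (i, i) + S (j, j) + 2 * e * S (i, j))"
  define D where "D = (\<lambda>e X. \<Sum>l<n. (X l i + e * X l j)\<^sup>2 - v e)"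
  \<comment> \<open>The event e' D e \<ge> 2 n t, multiplied by s = t/32. As v \<le> 4, the Chernoff
    exponent is at most 32 n s^2 - 2 n t s, and this s minimizes it, with value -n t^2/32. It also
    gives |s v| \<le> t/8 \<le> 1/4.\<close>
  define B where "B = (\<lambda>(e, e'). {X \<in> space ?P. (e' * t / 32) * D e X \<ge> real n * t\<^sup>2 / 16})"
  have [measurable]: "D e \<in> borel_measurable ?P" for e
    unfolding D_def using ij by measurable
  have B: "emeasure ?P (B (e, e')) \<le> ennreal (exp (- (real n * t\<^sup>2 / 32)))"
    if e: "\<bar>e\<bar> = 1" "\<bar>e'\<bar> = 1" for e e'
  proof -
    define a :: "nat \<Rightarrow> real" where "a = (\<lambda>k. (if k = i then 1 else 0) + (if k = j then e else 0))"
    have a: "(\<Sum>k<p. a k * f k) = f i + e * f j" for f :: "nat \<Rightarrow> real"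
      using ij by (simp add: a_def distrib_right sum.distrib if_distrib[of "\<lambda>x. x * _"] cong: if_cong)
    have "(\<Sum>k<p. \<Sum>l<p. a k * S (k, l) * a l) = (\<Sum>k<p. a k * (\<Sum>l<p. a l * S (k, l)))"
      by (simp add: sum_distrib_left mult_ac)
    also have "\<dots> = S (i, i) + e * e * S (j, j) + 2 * e * S (i, j)"
      using S ij by (simp only: a) (simp add: covariance_mat_def algebra_simps)
    also have "e * e = 1" using e by (metis abs_mult_self_eq mult_1)
    finally have ve: "v e = (\<Sum>k<p. \<Sum>l<p. a k * S (k, l) * a l)" by (simp add: v_def)
    have v4: "0 \<le> v e" "v e \<le> 4"
      using covariance_entry_bound[OF S ij d e(1)] by (auto simp: v_def)
    have sv: "\<bar>e' * t / 32 * v e\<bar> \<le> t / 8"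
      using v4 t e mult_mono[of t t "v e" 4] by (simp add: abs_mult)
    then have sv2: "(e' * t / 32 * v e)\<^sup>2 \<le> t\<^sup>2 / 64"
      using power_mono[OF sv, of 2] by (simp add: power_divide)
    have "emeasure ?P (B (e, e')) \<le>
        ennreal (exp (real n * (2 * (e' * t / 32 * v e)\<^sup>2) - real n * t\<^sup>2 / 16))"
      using sample_quadratic_tail[OF S ve, of "e' * t / 32" n "real n * t\<^sup>2 / 16"] sv t
      by (simp add: B_def D_def a)
    also have "\<dots> \<le> ennreal (exp (- (real n * t\<^sup>2 / 32)))"
      using mult_left_mono[OF sv2, of "real n"] by (intro ennreal_leI) (simp add: algebra_simps)
    finally show ?thesis .
  qed
  let ?J = "{1, -1 :: real} \<times> {1, -1 :: real}"
  have "?E \<subseteq> (\<Union>q\<in>?J. B q)"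
  proof
    fix X assume X: "X \<in> ?E"
    have "4 * (real n * sample_cov n p X (i, j)) - 4 * (real n * S (i, j)) = D 1 X - D (-1) X"
      using ij n by (simp add: sample_cov_def idx_def D_def v_def sum_subtractf[symmetric]
          sum_distrib_left power2_eq_square algebra_simps)
        (simp add: sum.distrib sum_subtractf)
    moreover have "real n * t < real n * \<bar>sample_cov n p X (i, j) - S (i, j)\<bar>"
      using X n by (intro mult_strict_left_mono) auto
    then have "real n * t < \<bar>real n * sample_cov n p X (i, j) - real n * S (i, j)\<bar>"
      by (simp add: abs_mult right_diff_distrib[symmetric])
    ultimately have "4 * (real n * t) < \<bar>D 1 X - D (-1) X\<bar>" by linarith
    then obtain e e' :: real where e: "(e, e') \<in> ?J" "2 * (real n * t) < e' * D e X"
    proof -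
      have "2 * (real n * t) < D 1 X \<or> 2 * (real n * t) < - D 1 X \<or>
          2 * (real n * t) < D (-1) X \<or> 2 * (real n * t) < - D (-1) X"
        using \<open>4 * (real n * t) < \<bar>D 1 X - D (-1) X\<bar>\<close> by linarith
      then show ?thesis using that[of 1 1] that[of 1 "-1"] that[of "-1" 1] that[of "-1" "-1"] by auto
    qed
    have "t / 32 * (2 * (real n * t)) \<le> t / 32 * (e' * D e X)"
      using e(2) t by (intro mult_left_mono) auto
    then have "X \<in> B (e, e')"
      using X by (simp add: B_def power2_eq_square algebra_simps)
    then show "X \<in> (\<Union>q\<in>?J. B q)" using e(1) by blast
  qed
  then have "emeasure ?P ?E \<le> emeasure ?P (\<Union>q\<in>?J. B q)"
    by (intro emeasure_mono) (auto simp: B_def)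
  also have "\<dots> \<le> (\<Sum>q\<in>?J. emeasure ?P (B q))"
    by (rule emeasure_subadditive_finite) (auto simp: B_def)
  also have "\<dots> \<le> (\<Sum>q\<in>?J. ennreal (exp (- (real n * t\<^sup>2 / 32))))"
    by (rule sum_mono) (auto intro!: B)
  also have "\<dots> = ennreal (4 * exp (- (real n * t\<^sup>2 / 32)))"
    by (simp add: ennreal_mult card_cartesian_product)
  finally show ?thesis .
qed

lemma sample_cov_concentration:
  assumes S: "covariance_mat p S" and m: "S \<in> moment_class p"
    and n: "n \<ge> 1" and t: "0 \<le> t" "t \<le> 1"
  shows "\<exists>E\<in>sets (sample_law n p S).
     emeasure (sample_law n p S) E \<le> ennreal (4 * (real p)\<^sup>2 * exp (- (real n * t\<^sup>2 / 32))) \<and>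
     (\<forall>X\<in>space (sample_law n p S) - E. \<forall>i<p. \<forall>j<p. \<bar>sample_cov n p X (i, j) - S (i, j)\<bar> \<le> t)"
proof -
  let ?P = "sample_law n p S"
  define B where "B = (\<lambda>(i, j). {X \<in> space ?P. \<bar>sample_cov n p X (i, j) - S (i, j)\<bar> > t})"
  have B_sets: "B (i, j) \<in> sets ?P" if "i < p" "j < p" for i j
    unfolding B_def sample_cov_def using that by (simp add: idx_def) measurable
  have B: "emeasure ?P (B (i, j)) \<le> ennreal (4 * exp (- (real n * t\<^sup>2 / 32)))" if "i < p" "j < p" for i j
    using sample_cov_entry_tail[OF S that moment_class_diag_le_1[OF S m] moment_class_diag_le_1[OF S m] n t]
      that by (simp add: B_def)
  let ?E = "\<Union>ij\<in>idx p. B ij"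
  have fin: "finite (idx p)" by (simp add: idx_def)
  have sub: "B ` idx p \<subseteq> sets ?P" using B_sets by (auto simp: idx_def)
  have "emeasure ?P ?E \<le> (\<Sum>ij\<in>idx p. emeasure ?P (B ij))"
    using sub fin by (intro emeasure_subadditive_finite) auto
  also have "\<dots> \<le> (\<Sum>ij\<in>idx p. ennreal (4 * exp (- (real n * t\<^sup>2 / 32))))"
    by (intro sum_mono) (auto simp: idx_def intro!: B)
  also have "\<dots> = ennreal (4 * (real p)\<^sup>2 * exp (- (real n * t\<^sup>2 / 32)))"
    by (simp add: idx_def card_cartesian_product ennreal_mult[symmetric] power2_eq_square
        ennreal_of_nat_eq_real_of_nat mult_ac flip: of_nat_mult)
  finally have "emeasure ?P ?E \<le> ennreal (4 * (real p)\<^sup>2 * exp (- (real n * t\<^sup>2 / 32)))" .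
  moreover have "?E \<in> sets ?P" using sub fin by (intro sets.finite_UN) auto
  moreover have "\<forall>X\<in>space ?P - ?E. \<forall>i<p. \<forall>j<p. \<bar>sample_cov n p X (i, j) - S (i, j)\<bar> \<le> t"
    by (auto simp: B_def idx_def not_less)
  ultimately show ?thesis by blast
qed

section \<open>Bands and their weights close to the truth\<close>

definition band_idx :: "nat \<Rightarrow> nat \<Rightarrow> (nat \<times> nat) set" where
  "band_idx p I = {(i, j) \<in> idx p. \<bar>int i - int j\<bar> \<le> int I}"

lemma finite_idx [simp]: "finite (idx p)"
  by (simp add: idx_def)

lemma band_idx_subset: "band_idx p I \<subseteq> idx p"
  by (auto simp: band_idx_def)

lemma finite_band_idx [simp]: "finite (band_idx p I)"
  by (rule finite_subset[OF band_idx_subset]) simp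

lemma band_idx_mono: "I \<le> J \<Longrightarrow> band_idx p I \<subseteq> band_idx p J"
  by (auto simp: band_idx_def)

lemma rho_Suc: "rho p (Suc I) = rho p I + (real p - real (Suc I))"
  by (simp add: rho_def field_simps)

lemma rho_mono:
  assumes "I \<le> J" "J \<le> p"
  shows "rho p I \<le> rho p J"
  using assms
proof (induction J rule: dec_induct)
  case (step J)
  then show ?case by (simp add: rho_Suc)
qed simp

lemma rho_ge_p: "I \<le> p \<Longrightarrow> real p \<le> rho p I"
  using rho_mono[of 0 I p] by (simp add: rho_def)

text \<open>\<open>rho p I\<close> is the dimension of the symmetric band: the diagonal and one
  entry of each mirrored pair. Doubling it counts the diagonal twice, whence the correction by p.
  Each step of the induction adds two off-diagonals of length \<open>p - Suc I\<close>.\<close>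

lemma card_band_idx:
  assumes "I \<le> p"
  shows "real (card (band_idx p I)) = 2 * rho p I - real p"
  using assms
proof (induction I)
  case 0
  have "band_idx p 0 = (\<lambda>i. (i, i)) ` {..<p}"
    by (auto simp: band_idx_def idx_def)
  then show ?case by (simp add: card_image inj_on_def rho_def)
next
  case (Suc I)
  let ?A = "(\<lambda>i. (i, i + Suc I)) ` {..<p - Suc I}" and ?B = "(\<lambda>i. (i + Suc I, i)) ` {..<p - Suc I}"
  have "band_idx p (Suc I) = band_idx p I \<union> (?A \<union> ?B)"
  proof (intro equalityI subsetI)
    fix x assume "x \<in> band_idx p (Suc I)"
    then obtain i j where x: "x = (i, j)" "i < p" "j < p" "\<bar>int i - int j\<bar> \<le> int (Suc I)"
      by (auto simp: band_idx_def idx_def)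
    then consider "\<bar>int i - int j\<bar> \<le> int I" | "j = i + Suc I" | "i = j + Suc I" by linarith
    then show "x \<in> band_idx p I \<union> (?A \<union> ?B)"
      by cases (use x in \<open>auto simp: band_idx_def idx_def image_iff\<close>)
  qed (auto simp: band_idx_def idx_def)
  moreover have "band_idx p I \<inter> (?A \<union> ?B) = {}" "?A \<inter> ?B = {}"
    by (auto simp: band_idx_def)
  moreover have "card ?A = p - Suc I" "card ?B = p - Suc I"
    by (subst card_image; simp add: inj_on_def)+
  ultimately have "card (band_idx p (Suc I)) = card (band_idx p I) + 2 * (p - Suc I)"
    by (simp add: card_Un_disjoint)
  then show ?case using Suc by (simp add: rho_Suc of_nat_diff)
qed

lemma card_band_idx_diff:
  assumes "I \<le> J" "J \<le> p"
  shows "real (card (band_idx p J - band_idx p I)) = 2 * (rho p J - rho p I)"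
proof -
  have "card (band_idx p J - band_idx p I) = card (band_idx p J) - card (band_idx p I)"
    by (rule card_Diff_subset) (simp_all add: band_idx_mono assms)
  then have "real (card (band_idx p J - band_idx p I)) = real (card (band_idx p J)) - real (card (band_idx p I))"
    using card_mono[OF finite_band_idx band_idx_mono[OF assms(1)], of p] by simp
  then show ?thesis using assms by (simp add: card_band_idx)
qed

lemma bias2_eq: "bias2 p I f = (\<Sum>ij\<in>idx p - band_idx p I. (f ij)\<^sup>2)"
  unfolding bias2_def by (rule sum.cong) (auto simp: band_idx_def)

lemma bias2_nonneg: "0 \<le> bias2 p I f"
  unfolding bias2_eq by (rule sum_nonneg) simp

lemma bias2_diff:
  assumes "I \<le> J"
  shows "bias2 p I f - bias2 p J f = (\<Sum>ij\<in>band_idx p J - band_idx p I. (f ij)\<^sup>2)"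
proof -
  have "idx p - band_idx p I = (idx p - band_idx p J) \<union> (band_idx p J - band_idx p I)"
    using band_idx_mono[OF assms, of p] band_idx_subset by blast
  moreover have "(idx p - band_idx p J) \<inter> (band_idx p J - band_idx p I) = {}" by blast
  ultimately show ?thesis
    unfolding bias2_eq by (simp add: sum.union_disjoint)
qed

lemma bias2_antimono: "I \<le> J \<Longrightarrow> bias2 p J f \<le> bias2 p I f"
  using bias2_diff[of I J p f] sum_nonneg[of "band_idx p J - band_idx p I" "\<lambda>ij. (f ij)\<^sup>2"] by simp

lemma frob_sq: "(frob p x)\<^sup>2 = (\<Sum>ij\<in>idx p. (x ij)\<^sup>2)"
  by (simp add: frob_def L2_set_def sum_nonneg)

text \<open>On symmetric matrices the symmetrization in the projection does nothing, and only
  truncation to the band remains.\<close>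

lemma band_proj_entry:
  assumes sym: "\<And>i j. i < p \<Longrightarrow> j < p \<Longrightarrow> x (i, j) = x (j, i)" and ij: "ij \<in> idx p"
  shows "band_proj p I x ij = (if ij \<in> band_idx p I then x ij else 0)"
proof -
  obtain i j where ij': "ij = (i, j)" "i < p" "j < p" using ij by (auto simp: idx_def)
  then show ?thesis using sym[of i j] by (simp add: band_proj_eq band_idx_def idx_def)
qed

text \<open>Since I \<le> p \<le> \<open>rho p I\<close>, a geometric series dominates the sum,
  uniformly in p.\<close>

lemma sum_exp_rho_le:
  assumes "\<nu> > 0"
  shows "(\<Sum>I\<in>{0..p}. exp (- \<nu> * rho p I)) \<le> exp \<nu> / (exp \<nu> - 1)"
proof -
  have e: "0 < exp (- \<nu>)" "exp (- \<nu>) < 1" using assms by auto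
  have "(\<Sum>I\<in>{0..p}. exp (- \<nu> * rho p I)) \<le> (\<Sum>I\<in>{0..p}. exp (- \<nu>) ^ I)"
  proof (rule sum_mono)
    fix I assume "I \<in> {0..p}"
    then have "real I \<le> rho p I" using rho_ge_p[of I p] by simp
    then show "exp (- \<nu> * rho p I) \<le> exp (- \<nu>) ^ I"
      using assms by (simp add: exp_of_nat_mult[symmetric] mult.commute)
  qed
  also have "\<dots> \<le> 1 / (1 - exp (- \<nu>))"
    using e sum_le_suminf[OF summable_geometric, of "exp (- \<nu>)" "{0..p}"]
    by (simp add: suminf_geometric)
  also have "\<dots> = exp \<nu> / (exp \<nu> - 1)"
    using assms by (simp add: exp_minus field_simps)
  finally show ?thesis .
qed

text \<open>The two sides differ by (s + 3d)^2 / 3. The coefficient 2/3 is the one that goes with -2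
  d^2, so that after division by \<open>2 * \<sigma>\<^sup>2\<close> the noise costs one unit per
  dimension, as it does with \<open>square_upper_bound\<close>.\<close>

lemma square_lower_bound:
  fixes s d :: real
  shows "(2 / 3) * s\<^sup>2 - 2 * d\<^sup>2 \<le> (s + d)\<^sup>2"
  using zero_le_power2[of "s + 3 * d"] by (simp add: power2_eq_square algebra_simps)

lemma square_upper_bound:
  fixes s d :: real
  shows "(s + d)\<^sup>2 \<le> 2 * s\<^sup>2 + 2 * d\<^sup>2"
  using zero_le_power2[of "s - d"] by (simp add: power2_eq_square algebra_simps)

text \<open>The weighted variance is nonnegative.\<close>

lemma square_mean_le_mean_square:
  fixes w x :: "'a \<Rightarrow> real"
  assumes "\<And>i. i \<in> A \<Longrightarrow> 0 \<le> w i" "sum w A = 1"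
  shows "(\<Sum>i\<in>A. w i * x i)\<^sup>2 \<le> (\<Sum>i\<in>A. w i * (x i)\<^sup>2)"
proof -
  define m where "m = (\<Sum>i\<in>A. w i * x i)"
  have "0 \<le> (\<Sum>i\<in>A. w i * (x i - m)\<^sup>2)" using assms(1) by (intro sum_nonneg) simp
  also have "\<dots> = (\<Sum>i\<in>A. w i * (x i)\<^sup>2) - 2 * m * (\<Sum>i\<in>A. w i * x i) + m\<^sup>2 * sum w A"
    by (simp add: sum_distrib_left sum_subtractf[symmetric] sum.distrib[symmetric]
        power2_eq_square algebra_simps)
  also have "\<dots> = (\<Sum>i\<in>A. w i * (x i)\<^sup>2) - m\<^sup>2"
    by (simp add: assms(2) m_def[symmetric] power2_eq_square)
  finally show ?thesis by (simp add: m_def)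
qed

section \<open>Log-weights of bands, and their comparison on the good event\<close>

definition log_weight :: "nat \<Rightarrow> real \<Rightarrow> real \<Rightarrow> (nat \<times> nat \<Rightarrow> real) \<Rightarrow> nat \<Rightarrow> real" where
  "log_weight p \<kappa> \<sigma> y I = - \<kappa> * rho p I - bias2 p I y / (2 * \<sigma>\<^sup>2)"

lemma pi_tilde_idx_nonneg: "0 \<le> pi_tilde_idx p \<kappa> \<sigma> y I"
  unfolding pi_tilde_idx_def idx_weight_def by (intro divide_nonneg_nonneg sum_nonneg) auto

lemma sum_pi_tilde_idx: "(\<Sum>I\<in>{0..p}. pi_tilde_idx p \<kappa> \<sigma> y I) = 1"
proof -
  have "0 < (\<Sum>I\<in>{0..p}. idx_weight p \<kappa> \<sigma> y I)"
    by (rule sum_pos) (auto simp: idx_weight_def)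
  then show ?thesis by (simp add: pi_tilde_idx_def sum_divide_distrib[symmetric])
qed

text \<open>The deterministic setting: y stands for the sample covariance at one sample outside the
  bad event. The bounds on \<open>\<kappa>\<close> and \<open>c\<^sub>3\<close> are consequences of
  the choices in the theorem in which \<alpha> no longer occurs.\<close>

locale good_event =
  fixes p :: nat and \<sigma> \<kappa> \<nu> c\<^sub>3 :: real and S y :: "nat \<times> nat \<Rightarrow> real"
  assumes p: "p \<ge> 1" and \<sigma>: "\<sigma> > 0" and \<nu>: "\<nu> > 0"
    and \<kappa>: "\<kappa> \<ge> 8 * \<nu> + 5 / 2" and c3: "c\<^sub>3 \<ge> 6 + 4 * \<kappa>"
    and S_sym: "\<And>i j. i < p \<Longrightarrow> j < p \<Longrightarrow> S (i, j) = S (j, i)"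
    and y_sym: "\<And>i j. i < p \<Longrightarrow> j < p \<Longrightarrow> y (i, j) = y (j, i)"
    and y_space: "y \<in> space (mat_space p)"
    and close: "\<And>ij. ij \<in> idx p \<Longrightarrow> (y ij - S ij)\<^sup>2 \<le> \<sigma>\<^sup>2 / 2"
begin

abbreviation "L \<equiv> log_weight p \<kappa> \<sigma> y"
abbreviation "w \<equiv> pi_tilde_idx p \<kappa> \<sigma> y"
abbreviation "r2 I \<equiv> rate2 p \<sigma> I S"
abbreviation "R \<equiv> oracle_rate2 p \<sigma> S"

lemma rho_ge_1: "I \<le> p \<Longrightarrow> 1 \<le> rho p I"
  using rho_ge_p[of I p] p by linarith

lemma r2_ge: "I \<le> p \<Longrightarrow> \<sigma>\<^sup>2 \<le> r2 I"
  using bias2_nonneg[of p I S] rho_ge_1[of I] mult_left_mono[of 1 "rho p I" "\<sigma>\<^sup>2"]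
  by (simp add: rate2_def)

lemma R_le: "I \<le> p \<Longrightarrow> R \<le> r2 I"
  unfolding oracle_rate2_def by (rule Min_le) auto

lemma oracle_index:
  obtains I where "I \<le> p" "r2 I = R"
proof -
  have "R \<in> (\<lambda>I. r2 I) ` {0..p}"
    unfolding oracle_rate2_def by (rule Min_in) auto
  then show ?thesis using that by auto
qed

lemma R_ge: "\<sigma>\<^sup>2 \<le> R"
  using r2_ge oracle_index by metis

lemma R_pos: "R > 0"
  using R_ge zero_less_power[OF \<sigma>, of 2] by linarith

lemma idx_weight_eq: "idx_weight p \<kappa> \<sigma> y I = exp (L I)"
proof -
  have "(frob p (mdiff p y (band_proj p I y)))\<^sup>2 =
      (\<Sum>ij\<in>idx p. if ij \<in> band_idx p I then 0 else (y ij)\<^sup>2)"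
    unfolding frob_sq by (rule sum.cong) (auto simp: mdiff_def band_proj_entry[where x = y, OF y_sym])
  also have "\<dots> = bias2 p I y"
    unfolding bias2_eq by (rule sum.mono_neutral_cong_right) auto
  finally show ?thesis
    by (simp add: idx_weight_def log_weight_def exp_add[symmetric])
qed

text \<open>The normalizing sum is at least its J-th term. J will be the index of the oracle
  rate.\<close>

lemma w_le:
  assumes "J \<le> p"
  shows "w I \<le> exp (L I - L J)"
proof -
  have "exp (L J) \<le> (\<Sum>K\<in>{0..p}. exp (L K))"
    using assms by (intro member_le_sum) auto
  then have "w I \<le> exp (L I) / exp (L J)"
    unfolding pi_tilde_idx_def idx_weight_eq by (intro divide_left_mono mult_pos_pos sum_pos) auto
  then show ?thesis by (simp add: exp_diff)
qed

lemma noise_band_diff: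
  assumes "I \<le> J" "J \<le> p"
  shows "(\<Sum>ij\<in>band_idx p J - band_idx p I. (y ij - S ij)\<^sup>2) \<le> \<sigma>\<^sup>2 * (rho p J - rho p I)"
proof -
  have "(\<Sum>ij\<in>band_idx p J - band_idx p I. (y ij - S ij)\<^sup>2) \<le>
      real (card (band_idx p J - band_idx p I)) * (\<sigma>\<^sup>2 / 2)"
    using band_idx_subset[of p J] by (intro sum_bounded_above close) blast
  then show ?thesis by (simp add: card_band_idx_diff[OF assms] algebra_simps)
qed

lemma noise_band:
  assumes "I \<le> p"
  shows "(\<Sum>ij\<in>band_idx p I. (y ij - S ij)\<^sup>2) \<le> \<sigma>\<^sup>2 * rho p I"
proof -
  have "(\<Sum>ij\<in>band_idx p I. (y ij - S ij)\<^sup>2) \<le> real (card (band_idx p I)) * (\<sigma>\<^sup>2 / 2)"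
    using band_idx_subset[of p I] by (intro sum_bounded_above close) blast
  also have "\<dots> = \<sigma>\<^sup>2 * rho p I - real p * \<sigma>\<^sup>2 / 2"
    by (simp add: card_band_idx[OF assms] field_simps)
  also have "\<dots> \<le> \<sigma>\<^sup>2 * rho p I" by simp
  finally show ?thesis .
qed

text \<open>Going to a larger band costs \<open>\<kappa>\<close> per dimension and gains at most 1
  per dimension by fitting noise, besides the bias removed. The factor 2 of
  \<open>square_upper_bound\<close> cancels against the 2 in the weight.\<close>

lemma log_weight_up:
  assumes "I \<le> J" "J \<le> p"
  shows "L J - L I \<le> (1 - \<kappa>) * (rho p J - rho p I) + (bias2 p I S - bias2 p J S) / \<sigma>\<^sup>2"
proof -
  let ?A = "band_idx p J - band_idx p I"
  have "bias2 p I y - bias2 p J y = (\<Sum>ij\<in>?A. (S ij + (y ij - S ij))\<^sup>2)"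
    by (simp add: bias2_diff[OF assms(1)])
  also have "\<dots> \<le> (\<Sum>ij\<in>?A. 2 * (S ij)\<^sup>2 + 2 * (y ij - S ij)\<^sup>2)"
    by (intro sum_mono square_upper_bound)
  also have "\<dots> = 2 * (bias2 p I S - bias2 p J S) + 2 * (\<Sum>ij\<in>?A. (y ij - S ij)\<^sup>2)"
    by (simp add: bias2_diff[OF assms(1)] sum.distrib sum_distrib_left)
  also have "\<dots> \<le> 2 * (bias2 p I S - bias2 p J S) + 2 * (\<sigma>\<^sup>2 * (rho p J - rho p I))"
    using noise_band_diff[OF assms] by simp
  finally have "(bias2 p I y - bias2 p J y) / (2 * \<sigma>\<^sup>2) \<le>
      (2 * (bias2 p I S - bias2 p J S) + 2 * (\<sigma>\<^sup>2 * (rho p J - rho p I))) / (2 * \<sigma>\<^sup>2)"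
    by (intro divide_right_mono) auto
  also have "\<dots> = (bias2 p I S - bias2 p J S) / \<sigma>\<^sup>2 + (rho p J - rho p I)"
    using \<sigma> by (simp add: field_simps)
  finally show ?thesis
    by (simp add: log_weight_def diff_divide_distrib algebra_simps)
qed

text \<open>Going to a smaller band saves \<open>\<kappa>\<close> per dimension and at most 1 more
  through the noise, while at least a third of the additional bias, in units of
  \<open>\<sigma>\<^sup>2\<close>, is lost.\<close>

lemma log_weight_low:
  assumes "I \<le> J" "J \<le> p"
  shows "L I - L J \<le> (\<kappa> + 1) * (rho p J - rho p I) - (bias2 p I S - bias2 p J S) / (3 * \<sigma>\<^sup>2)"
proof -
  let ?A = "band_idx p J - band_idx p I"
  have "(2 / 3) * (bias2 p I S - bias2 p J S) - 2 * (\<sigma>\<^sup>2 * (rho p J - rho p I)) \<le>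
      (2 / 3) * (bias2 p I S - bias2 p J S) - 2 * (\<Sum>ij\<in>?A. (y ij - S ij)\<^sup>2)"
    using noise_band_diff[OF assms] by simp
  also have "\<dots> = (\<Sum>ij\<in>?A. (2 / 3) * (S ij)\<^sup>2 - 2 * (y ij - S ij)\<^sup>2)"
    by (simp add: bias2_diff[OF assms(1)] sum_subtractf sum_distrib_left)
  also have "\<dots> \<le> (\<Sum>ij\<in>?A. (S ij + (y ij - S ij))\<^sup>2)"
    by (intro sum_mono square_lower_bound)
  also have "\<dots> = bias2 p I y - bias2 p J y"
    by (simp add: bias2_diff[OF assms(1)])
  finally have "((2 / 3) * (bias2 p I S - bias2 p J S) - 2 * (\<sigma>\<^sup>2 * (rho p J - rho p I))) / (2 * \<sigma>\<^sup>2) \<le>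
      (bias2 p I y - bias2 p J y) / (2 * \<sigma>\<^sup>2)"
    by (intro divide_right_mono) auto
  moreover have "((2 / 3) * (bias2 p I S - bias2 p J S) - 2 * (\<sigma>\<^sup>2 * (rho p J - rho p I))) / (2 * \<sigma>\<^sup>2) =
      (bias2 p I S - bias2 p J S) / (3 * \<sigma>\<^sup>2) - (rho p J - rho p I)"
    using \<sigma> by (simp add: field_simps)
  ultimately show ?thesis
    by (simp add: log_weight_def diff_divide_distrib algebra_simps)
qed

text \<open>The excess rate of I is either dimension or bias. If Io \<le> I, the bias of I is at
  most that of Io, so the excess sits in \<open>rho p I\<close> and the penalty pays for it.
  Otherwise the excess in \<open>base\<close> is charged to the bias of I, a third of which counts
  in the log-weight. Both cases leave room beyond m/16, the decay from which
  \<open>c\<^sub>2\<close> is obtained.\<close>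

lemma log_weight_bad:
  assumes I: "I \<le> p" and Io: "Io \<le> p" "r2 Io = R" and m: "m \<ge> 0" and bad: "r2 I \<ge> c\<^sub>3 * R + m * \<sigma>\<^sup>2"
  shows "L I - L Io \<le> - \<nu> * rho p I - m / 16"
proof -
  \<comment> \<open>Biases and dimensions of Io and I, with everything measured in units of
    \<open>\<sigma>\<^sup>2\<close>.\<close>
  define a b x z where "a = bias2 p Io S / \<sigma>\<^sup>2" and "b = bias2 p I S / \<sigma>\<^sup>2"
    and "x = rho p Io" and "z = rho p I"
  have nn: "0 \<le> a" "0 \<le> b" "1 \<le> x" "1 \<le> z"
    unfolding a_def b_def x_def z_def
    by (intro divide_nonneg_nonneg bias2_nonneg zero_le_power2 rho_ge_1 I Io(1))+
  have "c\<^sub>3 * (a + x) + m \<le> b + z"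
  proof -
    have "(c\<^sub>3 * R + m * \<sigma>\<^sup>2) / \<sigma>\<^sup>2 \<le> r2 I / \<sigma>\<^sup>2" using bad by (intro divide_right_mono) auto
    then show ?thesis
      unfolding Io(2)[symmetric] using \<sigma>
      by (simp add: rate2_def a_def b_def x_def z_def add_divide_distrib distrib_left)
  qed
  moreover have "(6 + 4 * \<kappa>) * (a + x) \<le> c\<^sub>3 * (a + x)" using c3 nn by (intro mult_right_mono) auto
  ultimately have base: "(6 + 4 * \<kappa>) * (a + x) + m \<le> b + z" by linarith
  then have base': "6 * a + 6 * x + 4 * (\<kappa> * a) + 4 * (\<kappa> * x) + m \<le> b + z"
    by (simp add: algebra_simps)
  have kx: "0 \<le> \<kappa> * x" "0 \<le> \<kappa> * a" "0 \<le> \<kappa> * z" using \<kappa> \<nu> nn by auto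
  have "L I - L Io \<le> - \<nu> * z - m / 16"
  proof (cases "Io \<le> I")
    case True
    have "L I - L Io \<le> (1 - \<kappa>) * (z - x) + (a - b)"
      using log_weight_up[OF True I] by (simp add: a_def b_def x_def z_def diff_divide_distrib)
    moreover have "b \<le> a"
      unfolding a_def b_def by (intro divide_right_mono bias2_antimono True) simp
    then have z: "(5 + 4 * \<kappa>) * a + (6 + 4 * \<kappa>) * x + m \<le> z"
      using base by (simp add: algebra_simps)
    \<comment> \<open>Of the penalty on z, \<nu> z is kept for the claim; the remaining (3/2) z
      absorbs the terms in x and a and the m/16 by the lower bound \<open>z\<close>.\<close>
    have "0 \<le> (\<kappa> - 1 - \<nu> - 3 / 2) * z" using \<kappa> \<nu> nn by (intro mult_nonneg_nonneg) auto
    ultimately show ?thesis using z kx nn m by (simp add: algebra_simps)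
  next
    case False
    then have "I \<le> Io" by simp
    have "L I - L Io \<le> (\<kappa> + 1) * (x - z) - (b - a) / 3"
      using log_weight_low[OF \<open>I \<le> Io\<close> Io(1)]
      by (simp add: a_def b_def x_def z_def diff_divide_distrib)
    then have "3 * (L I - L Io) \<le> 3 * (\<kappa> * x) - 3 * (\<kappa> * z) + 3 * x - 3 * z - (b - a)"
      by (simp add: field_simps)
    moreover have "0 \<le> (\<kappa> - \<nu>) * z" using \<kappa> \<nu> nn by (intro mult_nonneg_nonneg) auto
    then have "\<nu> * z \<le> \<kappa> * z" by (simp add: algebra_simps)
    \<comment> \<open>By \<open>base'\<close> the loss b - a exceeds the gain 3 \<kappa> x + 3 x and
      still leaves m, up to a single z that is covered by -3 z.\<close>
    ultimately show ?thesis using base' kx nn m by argo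
  qed
  then show ?thesis by (simp add: z_def)
qed

lemma w_bad:
  assumes "I \<le> p" "m \<ge> 0" "r2 I \<ge> c\<^sub>3 * R + m * \<sigma>\<^sup>2"
  shows "w I \<le> exp (- \<nu> * rho p I) * exp (- m / 16)"
proof -
  obtain Io where Io: "Io \<le> p" "r2 Io = R" by (rule oracle_index)
  have "w I \<le> exp (L I - L Io)" by (rule w_le[OF Io(1)])
  also have "\<dots> \<le> exp (- \<nu> * rho p I - m / 16)"
    using log_weight_bad[OF assms(1) Io assms(2,3)] by simp
  finally show ?thesis by (simp add: exp_add[symmetric])
qed

lemma sum_w_bad:
  assumes "m \<ge> 0"
  shows "(\<Sum>I\<in>{0..p} \<inter> {I. r2 I \<ge> c\<^sub>3 * R + m * \<sigma>\<^sup>2}. w I) \<le> exp \<nu> / (exp \<nu> - 1) * exp (- m / 16)"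
proof -
  let ?G = "{0..p} \<inter> {I. r2 I \<ge> c\<^sub>3 * R + m * \<sigma>\<^sup>2}"
  have "(\<Sum>I\<in>?G. w I) \<le> (\<Sum>I\<in>?G. exp (- \<nu> * rho p I) * exp (- m / 16))"
    by (intro sum_mono w_bad) (auto simp: assms)
  also have "\<dots> \<le> (\<Sum>I\<in>{0..p}. exp (- \<nu> * rho p I) * exp (- m / 16))"
    by (intro sum_mono2) auto
  also have "\<dots> = (\<Sum>I\<in>{0..p}. exp (- \<nu> * rho p I)) * exp (- m / 16)"
    by (simp add: sum_distrib_right)
  also have "\<dots> \<le> exp \<nu> / (exp \<nu> - 1) * exp (- m / 16)"
    by (intro mult_right_mono sum_exp_rho_le \<nu>) simp
  finally show ?thesis .
qed

text \<open>Each bad band is measured by its own excess m: its mass decays like exp(-m/16), which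
  beats the linear growth of its rate, and the factors exp(-\<nu> rho) make the sum over bands
  finite uniformly in p.\<close>

lemma sum_w_rate: "(\<Sum>I\<in>{0..p}. w I * r2 I) \<le> (c\<^sub>3 + 16 * (exp \<nu> / (exp \<nu> - 1))) * R"
proof -
  have "w I * r2 I \<le> w I * (c\<^sub>3 * R) + 16 * \<sigma>\<^sup>2 * exp (- \<nu> * rho p I)" if "I \<le> p" for I
  proof (cases "r2 I \<ge> c\<^sub>3 * R")
    case False
    then have "w I * r2 I \<le> w I * (c\<^sub>3 * R)"
      by (intro mult_left_mono pi_tilde_idx_nonneg) simp
    moreover have "0 \<le> 16 * \<sigma>\<^sup>2 * exp (- \<nu> * rho p I)" by simp
    ultimately show ?thesis by linarith
  next
    case True
    define m where "m = (r2 I - c\<^sub>3 * R) / \<sigma>\<^sup>2"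
    have m: "m \<ge> 0" "r2 I = c\<^sub>3 * R + m * \<sigma>\<^sup>2" using True \<sigma> by (auto simp: m_def)
    \<comment> \<open>The constant 16 comes from u \<le> exp u at u = m/16.\<close>
    have "m / 16 * exp (- m / 16) \<le> exp (m / 16) * exp (- m / 16)"
      by (rule mult_right_mono) (use exp_ge_add_one_self[of "m / 16"] in linarith, simp)
    then have me: "m * exp (- m / 16) \<le> 16" by (simp add: exp_add[symmetric])
    have "w I * (m * \<sigma>\<^sup>2) \<le> (exp (- \<nu> * rho p I) * exp (- m / 16)) * (m * \<sigma>\<^sup>2)"
      using w_bad[OF that m(1)] m by (intro mult_right_mono) auto
    also have "\<dots> = (\<sigma>\<^sup>2 * exp (- \<nu> * rho p I)) * (m * exp (- m / 16))" by simp
    also have "\<dots> \<le> (\<sigma>\<^sup>2 * exp (- \<nu> * rho p I)) * 16" using me by (intro mult_left_mono) auto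
    finally show ?thesis using m(2) by (simp add: distrib_left)
  qed
  then have "(\<Sum>I\<in>{0..p}. w I * r2 I) \<le> (\<Sum>I\<in>{0..p}. w I * (c\<^sub>3 * R) + 16 * \<sigma>\<^sup>2 * exp (- \<nu> * rho p I))"
    by (intro sum_mono) auto
  also have "\<dots> = c\<^sub>3 * R + 16 * \<sigma>\<^sup>2 * (\<Sum>I\<in>{0..p}. exp (- \<nu> * rho p I))"
    by (simp add: sum.distrib sum_distrib_left[symmetric] sum_distrib_right[symmetric] sum_pi_tilde_idx)
  also have "\<dots> \<le> c\<^sub>3 * R + 16 * R * (exp \<nu> / (exp \<nu> - 1))"
    using R_ge \<nu> by (intro add_left_mono mult_mono sum_exp_rho_le) (auto intro: sum_nonneg order.trans[OF _ R_ge])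
  finally show ?thesis by (simp add: algebra_simps)
qed

text \<open>Entries inside the band carry only noise and entries outside only bias, so the two parts
  of the rate add up with constant 1.\<close>

lemma band_proj_error:
  assumes "I \<le> p"
  shows "(frob p (mdiff p (band_proj p I y) S))\<^sup>2 \<le> r2 I"
proof -
  have "(frob p (mdiff p (band_proj p I y) S))\<^sup>2 =
      (\<Sum>ij\<in>idx p. if ij \<in> band_idx p I then (y ij - S ij)\<^sup>2 else (S ij)\<^sup>2)"
    unfolding frob_sq by (rule sum.cong) (auto simp: mdiff_def band_proj_entry[where x = y, OF y_sym])
  also have "\<dots> = (\<Sum>ij\<in>band_idx p I. (y ij - S ij)\<^sup>2) + bias2 p I S"
    unfolding bias2_eq
    by (subst sum.If_cases) (auto intro!: arg_cong2[where f = "(+)"] sum.cong simp: band_idx_subset[THEN subsetD])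
  also have "\<dots> \<le> r2 I" using noise_band[OF assms] by (simp add: rate2_def)
  finally show ?thesis .
qed

text \<open>Convexity of the square, entry by entry, bounds the error of the mixture mean by the
  average of the errors of the bands.\<close>

lemma mixture_mean_error:
  "(frob p (mdiff p (ddm_mean Mixed p \<kappa> \<sigma> Ihat y) S))\<^sup>2 \<le> (c\<^sub>3 + 16 * (exp \<nu> / (exp \<nu> - 1))) * R"
proof -
  let ?e = "\<lambda>I ij. band_proj p I y ij - S ij"
  have "(frob p (mdiff p (ddm_mean Mixed p \<kappa> \<sigma> Ihat y) S))\<^sup>2 =
      (\<Sum>ij\<in>idx p. (\<Sum>I\<in>{0..p}. w I * ?e I ij)\<^sup>2)"
    unfolding frob_sq
    by (rule sum.cong)
      (simp_all add: mdiff_def ddm_mean_def right_diff_distrib sum_subtractf sum_distrib_right[symmetric]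
        sum_pi_tilde_idx mult.commute[of _ "w _"])
  also have "\<dots> \<le> (\<Sum>ij\<in>idx p. \<Sum>I\<in>{0..p}. w I * (?e I ij)\<^sup>2)"
    by (intro sum_mono square_mean_le_mean_square pi_tilde_idx_nonneg sum_pi_tilde_idx)
  also have "\<dots> = (\<Sum>I\<in>{0..p}. w I * (frob p (mdiff p (band_proj p I y) S))\<^sup>2)"
    unfolding frob_sq by (subst sum.swap) (simp add: sum_distrib_left mdiff_def)
  also have "\<dots> \<le> (\<Sum>I\<in>{0..p}. w I * r2 I)"
    by (intro sum_mono mult_left_mono band_proj_error pi_tilde_idx_nonneg) auto
  also note sum_w_rate
  finally show ?thesis .
qed

end

lemma measurable_frob_band_proj:
  assumes "sets PZ = sets (mat_space p)"
  shows "(\<lambda>z. (frob p (band_proj p I z))\<^sup>2) \<in> borel_measurable PZ"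
  unfolding frob_sq
proof (rule borel_measurable_sum)
  fix ij assume "ij \<in> idx p"
  then obtain i j where ij: "ij = (i, j)" "(i, j) \<in> idx p" "(j, i) \<in> idx p" by (auto simp: idx_def)
  have "(\<lambda>z. z k) \<in> borel_measurable PZ" if "k \<in> idx p" for k
    using that measurable_component_singleton[of k "idx p" "\<lambda>_. borel :: real measure"]
    by (simp add: measurable_cong_sets[OF assms refl] mat_space_def)
  note this[OF ij(2), measurable] this[OF ij(3), measurable]
  show "(\<lambda>z. (band_proj p I z ij)\<^sup>2) \<in> borel_measurable PZ"
    using ij by (simp add: band_proj_eq)
qed

section \<open>The selected band, and the tails of the data dependent measures\<close>

context good_event
begin

lemma w_le_iff: "w I \<le> w J \<longleftrightarrow> L I \<le> L J"
proof -
  have "0 < (\<Sum>K\<in>{0..p}. exp (L K))" by (rule sum_pos) auto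
  then show ?thesis by (simp add: pi_tilde_idx_def idx_weight_eq divide_le_cancel)
qed

lemma selector_le:
  assumes "index_selector p \<kappa> \<sigma> Ihat"
  shows "Ihat y \<le> p"
  using assms y_space by (auto simp: index_selector_def is_arg_max_def)

lemma selector_max:
  assumes "index_selector p \<kappa> \<sigma> Ihat" "J \<le> p"
  shows "L J \<le> L (Ihat y)"
proof -
  have "w J \<le> w (Ihat y)"
    using assms y_space by (auto simp: index_selector_def is_arg_max_def not_less)
  then show ?thesis by (simp add: w_le_iff)
qed

text \<open>\<open>log_weight_bad\<close> with m = 0 already makes the log-weight strictly smaller
  than that of the oracle index, because \<nu> times the dimension is positive; a maximizer cannot
  have it.\<close>

lemma selector_rate:
  assumes "index_selector p \<kappa> \<sigma> Ihat"
  shows "r2 (Ihat y) < c\<^sub>3 * R"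
proof (rule ccontr)
  assume "\<not> r2 (Ihat y) < c\<^sub>3 * R"
  moreover obtain Io where Io: "Io \<le> p" "r2 Io = R" by (rule oracle_index)
  ultimately have "L (Ihat y) - L Io \<le> - \<nu> * rho p (Ihat y) - 0 / 16"
    using selector_le[OF assms] by (intro log_weight_bad) auto
  moreover have "0 < \<nu> * rho p (Ihat y)"
    using \<nu> rho_ge_1[OF selector_le[OF assms]] by simp
  ultimately show False using selector_max[OF assms Io(1)] by simp
qed

text \<open>If the selected band were smaller by d dimensions, minimality of Istar would give it an
  extra bias of at least \<open>\<tau> * \<sigma>\<^sup>2 * d\<close>. A third of it,
  \<open>\<tau> / 3 * d\<close>, outweighs the most that can be saved,
  \<open>(\<kappa> + 1) * d\<close>.\<close>

lemma selector_rho: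
  assumes "index_selector p \<kappa> \<sigma> Ihat" and "Istar \<le> p" and \<tau>: "\<tau> > 3 * \<kappa> + 3"
    and min: "\<And>I. I \<le> p \<Longrightarrow> bias2 p Istar S + \<tau> * \<sigma>\<^sup>2 * rho p Istar \<le> bias2 p I S + \<tau> * \<sigma>\<^sup>2 * rho p I"
  shows "rho p Istar \<le> rho p (Ihat y)"
proof (rule ccontr)
  let ?h = "Ihat y" and ?d = "rho p Istar - rho p (Ihat y)"
  assume "\<not> rho p Istar \<le> rho p ?h"
  then have d: "?d > 0" by simp
  then have le: "?h \<le> Istar"
    using rho_mono[of Istar ?h p] selector_le[OF assms(1)] by (cases "?h \<le> Istar") auto
  have "\<tau> * \<sigma>\<^sup>2 * ?d \<le> bias2 p ?h S - bias2 p Istar S"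
    using min[OF selector_le[OF assms(1)]] by (simp add: right_diff_distrib)
  then have "\<tau> * \<sigma>\<^sup>2 * ?d / (3 * \<sigma>\<^sup>2) \<le> (bias2 p ?h S - bias2 p Istar S) / (3 * \<sigma>\<^sup>2)"
    by (intro divide_right_mono) auto
  also have "\<tau> * \<sigma>\<^sup>2 * ?d / (3 * \<sigma>\<^sup>2) = \<tau> / 3 * ?d" using \<sigma> by simp
  finally have "L ?h - L Istar \<le> (\<kappa> + 1 - \<tau> / 3) * ?d"
    using log_weight_low[OF le assms(2)] unfolding left_diff_distrib by linarith
  also have "\<dots> < 0" using \<tau> d by (intro mult_neg_pos) auto
  finally show False using selector_max[OF assms(1,2)] by simp
qed

lemma ddm_idx_bad:
  assumes sel: "index_selector p \<kappa> \<sigma> Ihat" and "M \<ge> 0"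
  shows "ddm_idx kind p \<kappa> \<sigma> Ihat y {I. r2 I \<ge> c\<^sub>3 * R + M * \<sigma>\<^sup>2} \<le> exp \<nu> / (exp \<nu> - 1) * exp (- M / 16)"
proof (cases kind)
  case Mixed
  then show ?thesis using sum_w_bad[OF assms(2)] by (simp add: ddm_idx_def)
next
  case Selected
  have "\<not> r2 (Ihat y) \<ge> c\<^sub>3 * R + M * \<sigma>\<^sup>2"
    using selector_rate[OF sel] assms(2) by (smt (verit) mult_nonneg_nonneg zero_le_power2)
  then have "(\<Sum>I\<in>{0..p} \<inter> {I. r2 I \<ge> c\<^sub>3 * R + M * \<sigma>\<^sup>2}. if I = Ihat y then 1 else 0) = (0 :: real)"
    by (intro sum.neutral) auto
  then show ?thesis using Selected \<nu> by (simp add: ddm_idx_def)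
qed

lemma ddm_mean_error:
  assumes sel: "index_selector p \<kappa> \<sigma> Ihat"
  shows "(frob p (mdiff p (ddm_mean kind p \<kappa> \<sigma> Ihat y) S))\<^sup>2 \<le> (c\<^sub>3 + 16 * (exp \<nu> / (exp \<nu> - 1))) * R"
proof (cases kind)
  case Mixed
  then show ?thesis using mixture_mean_error by simp
next
  case Selected
  have "(frob p (mdiff p (ddm_mean kind p \<kappa> \<sigma> Ihat y) S))\<^sup>2 \<le> r2 (Ihat y)"
    using band_proj_error[OF selector_le[OF sel]] Selected by (simp add: ddm_mean_def)
  also have "\<dots> \<le> c\<^sub>3 * R" using selector_rate[OF sel] by simp
  also have "\<dots> \<le> (c\<^sub>3 + 16 * (exp \<nu> / (exp \<nu> - 1))) * R"
    using R_pos \<nu> by (intro mult_right_mono) auto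
  finally show ?thesis .
qed

text \<open>The error splits into the error of the centre, at most the rate of I, and \<sigma> times
  the projection of Z. Squaring doubles both parts, and Markov's inequality applies to the
  exponential moment of Z.\<close>

lemma pi_tilde_cond_tail:
  assumes I: "I \<le> p" and a: "a > 0" and Z: "admissible_Z p a PZ"
  shows "pi_tilde_cond p \<sigma> PZ I y {T \<in> space (mat_space p). (frob p (mdiff p T S))\<^sup>2 \<ge> K}
    \<le> exp (rho p I - a * (K - 2 * r2 I) / (2 * \<sigma>\<^sup>2))"
proof -
  interpret prob_space PZ using Z by (simp add: admissible_Z_def)
  define T where "T = (\<lambda>z. \<lambda>ij\<in>idx p. band_proj p I y ij + \<sigma> * band_proj p I z ij)"
  define A where "A = {z \<in> space PZ. T z \<in> {T \<in> space (mat_space p). (frob p (mdiff p T S))\<^sup>2 \<ge> K}}"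
  define s where "s = a * (K - 2 * r2 I) / (2 * \<sigma>\<^sup>2)"
  have err: "(frob p (mdiff p (T z) S))\<^sup>2 \<le> 2 * r2 I + 2 * \<sigma>\<^sup>2 * (frob p (band_proj p I z))\<^sup>2" for z
  proof -
    have "(frob p (mdiff p (T z) S))\<^sup>2 \<le>
        (\<Sum>ij\<in>idx p. 2 * (mdiff p (band_proj p I y) S ij)\<^sup>2 + 2 * (\<sigma> * band_proj p I z ij)\<^sup>2)"
      unfolding frob_sq
    proof (rule sum_mono)
      fix ij assume "ij \<in> idx p"
      then show "(mdiff p (T z) S ij)\<^sup>2 \<le>
          2 * (mdiff p (band_proj p I y) S ij)\<^sup>2 + 2 * (\<sigma> * band_proj p I z ij)\<^sup>2"
        using square_upper_bound[of "band_proj p I y ij - S ij" "\<sigma> * band_proj p I z ij"]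
        by (simp add: mdiff_def T_def algebra_simps)
    qed
    also have "\<dots> = 2 * (frob p (mdiff p (band_proj p I y) S))\<^sup>2 + 2 * \<sigma>\<^sup>2 * (frob p (band_proj p I z))\<^sup>2"
      unfolding frob_sq by (simp add: sum.distrib sum_distrib_left power_mult_distrib mult.assoc)
    also have "\<dots> \<le> 2 * r2 I + 2 * \<sigma>\<^sup>2 * (frob p (band_proj p I z))\<^sup>2"
      using band_proj_error[OF I] by simp
    finally show ?thesis .
  qed
  have sA: "s \<le> a * (frob p (band_proj p I z))\<^sup>2" if "z \<in> A" for z
  proof -
    have "K - 2 * r2 I \<le> 2 * \<sigma>\<^sup>2 * (frob p (band_proj p I z))\<^sup>2" using that err[of z] by (simp add: A_def)
    then have "a * (K - 2 * r2 I) / (2 * \<sigma>\<^sup>2) \<le> a * (2 * \<sigma>\<^sup>2 * (frob p (band_proj p I z))\<^sup>2) / (2 * \<sigma>\<^sup>2)"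
      using a by (intro divide_right_mono mult_left_mono) auto
    then show ?thesis using \<sigma> by (simp add: s_def)
  qed
  have "measure PZ A \<le> exp (rho p I - s)"
  proof (cases "A \<in> sets PZ")
    \<comment> \<open>\<open>measure\<close> is 0 on sets that are not measurable.\<close>
    case False
    then show ?thesis by (simp add: measure_notin_sets)
  next
    case True
    have [measurable]: "(\<lambda>z. (frob p (band_proj p I z))\<^sup>2) \<in> borel_measurable PZ"
      using Z by (intro measurable_frob_band_proj) (simp add: admissible_Z_def)
    have "emeasure PZ A = (\<integral>\<^sup>+ z. indicator A z \<partial>PZ)" using True by simp
    also have "\<dots> \<le> (\<integral>\<^sup>+ z. ennreal (exp (- s)) * ennreal (exp (a * (frob p (band_proj p I z))\<^sup>2)) \<partial>PZ)"
      using sA by (intro nn_integral_mono)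
        (auto simp: ennreal_mult[symmetric] exp_add[symmetric] split: split_indicator)
    also have "\<dots> = ennreal (exp (- s)) * (\<integral>\<^sup>+ z. ennreal (exp (a * (frob p (band_proj p I z))\<^sup>2)) \<partial>PZ)"
      by (rule nn_integral_cmult) measurable
    also have "\<dots> \<le> ennreal (exp (- s)) * ennreal (exp (rho p I))"
      using Z I by (intro mult_left_mono) (auto simp: admissible_Z_def)
    also have "\<dots> = ennreal (exp (rho p I - s))"
      by (simp add: ennreal_mult[symmetric] exp_add[symmetric])
    finally show ?thesis by (simp add: emeasure_eq_measure)
  qed
  then show ?thesis by (simp add: pi_tilde_cond_def A_def T_def s_def)
qed

text \<open>As \<open>\<sigma>\<^sup>2 * rho p I\<close> is at most the rate of I, the tail exponent
  is at most (2(1 + a) r2 - a K) / (2 \<sigma>^2). The factor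
  \<open>2 * c\<^sub>3 * (1 + 1 / a)\<close> in K cancels the part of r2 proportional to R. The
  excess a M / 8 uses up at most half of a M, as 1 + a \<le> 2, and the other half gives the
  bound.\<close>

lemma pi_tilde_cond_good:
  assumes I: "I \<le> p" and a: "a > 0" "a \<le> 1" and Z: "admissible_Z p a PZ" and M: "M \<ge> 0"
    and good: "r2 I < c\<^sub>3 * R + (a * M / 8) * \<sigma>\<^sup>2"
  shows "pi_tilde_cond p \<sigma> PZ I y
      {T \<in> space (mat_space p). (frob p (mdiff p T S))\<^sup>2 \<ge> 2 * c\<^sub>3 * (1 + 1 / a) * R + M * \<sigma>\<^sup>2}
    \<le> exp (- (a * M / 4))"
proof -
  let ?K = "2 * c\<^sub>3 * (1 + 1 / a) * R + M * \<sigma>\<^sup>2"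
  have "(1 + a) * r2 I \<le> (1 + a) * (c\<^sub>3 * R + (a * M / 8) * \<sigma>\<^sup>2)"
    using good a by (intro mult_left_mono) auto
  also have "\<dots> = (1 + a) * (c\<^sub>3 * R) + (1 + a) * ((a * M / 8) * \<sigma>\<^sup>2)" by (rule distrib_left)
  also have "(1 + a) * ((a * M / 8) * \<sigma>\<^sup>2) \<le> 2 * ((a * M / 8) * \<sigma>\<^sup>2)"
    using a M by (intro mult_right_mono) auto
  finally have 1: "(1 + a) * r2 I \<le> (1 + a) * (c\<^sub>3 * R) + a * M / 4 * \<sigma>\<^sup>2"
    by (simp add: mult_ac)
  have 2: "a * ?K = 2 * ((1 + a) * (c\<^sub>3 * R)) + a * M * \<sigma>\<^sup>2"
    using a by (simp add: field_simps)
  have "\<sigma>\<^sup>2 * rho p I \<le> r2 I" using bias2_nonneg by (simp add: rate2_def)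
  then have "2 * \<sigma>\<^sup>2 * rho p I - a * (?K - 2 * r2 I) \<le> 2 * ((1 + a) * r2 I) - a * ?K"
    by (simp add: algebra_simps)
  also have "\<dots> \<le> - (a * M / 2 * \<sigma>\<^sup>2)" using 1 2 by simp
  finally have "(2 * \<sigma>\<^sup>2 * rho p I - a * (?K - 2 * r2 I)) / (2 * \<sigma>\<^sup>2) \<le> - (a * M / 2 * \<sigma>\<^sup>2) / (2 * \<sigma>\<^sup>2)"
    by (intro divide_right_mono) auto
  then have "rho p I - a * (?K - 2 * r2 I) / (2 * \<sigma>\<^sup>2) \<le> - (a * M / 4)"
    using \<sigma> by (simp add: diff_divide_distrib)
  then have "exp (rho p I - a * (?K - 2 * r2 I) / (2 * \<sigma>\<^sup>2)) \<le> exp (- (a * M / 4))" by simp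
  with pi_tilde_cond_tail[OF I a(1) Z, of ?K] show ?thesis by linarith
qed

text \<open>Bands are split at excess a M / 8: those above have mass of order exp(-a M / 128) by
  \<open>sum_w_bad\<close>, which is the slower of the two decays and fixes the exponent; those
  below have small conditional tails. The selected band is always below.\<close>

lemma ddm_cov_tail:
  assumes sel: "index_selector p \<kappa> \<sigma> Ihat" and a: "a > 0" "a \<le> 1" and Z: "admissible_Z p a PZ"
    and M: "M \<ge> 0"
  shows "ddm_cov kind p \<kappa> \<sigma> PZ Ihat y
      {T \<in> space (mat_space p). (frob p (mdiff p T S))\<^sup>2 \<ge> 2 * c\<^sub>3 * (1 + 1 / a) * R + M * \<sigma>\<^sup>2}
    \<le> (1 + exp \<nu> / (exp \<nu> - 1)) * exp (- (a / 128) * M)" (is "ddm_cov _ _ _ _ _ _ _ ?B \<le> _")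
proof -
  let ?C = "exp \<nu> / (exp \<nu> - 1)" and ?P = "\<lambda>I. pi_tilde_cond p \<sigma> PZ I y ?B"
  let ?G = "{I. r2 I \<ge> c\<^sub>3 * R + (a * M / 8) * \<sigma>\<^sup>2}"
  interpret prob_space PZ using Z by (simp add: admissible_Z_def)
  have C: "0 \<le> ?C" using \<nu> by simp
  have aM: "0 \<le> a * M" using a M by simp
  have good: "?P I \<le> exp (- (a / 128) * M)" if "I \<le> p" "I \<notin> ?G" for I
  proof -
    have "?P I \<le> exp (- (a * M / 4))"
      using pi_tilde_cond_good[OF that(1) a Z M] that(2) by simp
    also have "\<dots> \<le> exp (- (a / 128) * M)" using a M by simp
    finally show ?thesis .
  qed
  show ?thesis
  proof (cases kind)
    case Selected
    have "Ihat y \<notin> ?G"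
      using selector_rate[OF sel] mult_nonneg_nonneg[OF aM zero_le_power2[of \<sigma>]] by simp
    then have "ddm_cov kind p \<kappa> \<sigma> PZ Ihat y ?B \<le> exp (- (a / 128) * M)"
      using good[OF selector_le[OF sel]] Selected by (simp add: ddm_cov_def)
    also have "\<dots> = 1 * exp (- (a / 128) * M)" by simp
    also have "\<dots> \<le> (1 + ?C) * exp (- (a / 128) * M)" using C by (intro mult_right_mono) auto
    finally show ?thesis .
  next
    case Mixed
    have "?P I * w I \<le> exp (- (a / 128) * M) * w I + (if I \<in> ?G then w I else 0)" if "I \<le> p" for I
    proof (cases "I \<in> ?G")
      case True
      have "?P I * w I \<le> 1 * w I"
        by (intro mult_right_mono pi_tilde_idx_nonneg) (simp add: pi_tilde_cond_def)
      also have "\<dots> \<le> exp (- (a / 128) * M) * w I + w I"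
        by (simp add: pi_tilde_idx_nonneg)
      finally show ?thesis using True by simp
    next
      case False
      then show ?thesis using mult_right_mono[OF good[OF that False] pi_tilde_idx_nonneg[of p \<kappa> \<sigma> y I]] by simp
    qed
    then have "(\<Sum>I\<in>{0..p}. ?P I * w I) \<le>
        (\<Sum>I\<in>{0..p}. exp (- (a / 128) * M) * w I + (if I \<in> ?G then w I else 0))"
      by (intro sum_mono) auto
    also have "\<dots> = exp (- (a / 128) * M) + (\<Sum>I\<in>{0..p} \<inter> ?G. w I)"
      by (simp add: sum.distrib sum_distrib_left[symmetric] sum_pi_tilde_idx sum.inter_restrict)
    also have "(\<Sum>I\<in>{0..p} \<inter> ?G. w I) \<le> ?C * exp (- (a * M / 8) / 16)"
      using aM by (intro sum_w_bad) simp
    finally show ?thesis using Mixed by (simp add: ddm_cov_def algebra_simps)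
  qed
qed

end

section \<open>Uniform bounds\<close>

lemma ddm_idx_le_1: "ddm_idx kind p \<kappa> \<sigma> Ihat y G \<le> 1"
proof (cases kind)
  case Mixed
  have "(\<Sum>I\<in>{0..p} \<inter> G. pi_tilde_idx p \<kappa> \<sigma> y I) \<le> (\<Sum>I\<in>{0..p}. pi_tilde_idx p \<kappa> \<sigma> y I)"
    by (intro sum_mono2) (auto intro: pi_tilde_idx_nonneg)
  then show ?thesis using Mixed by (simp add: ddm_idx_def sum_pi_tilde_idx)
next
  case Selected
  then show ?thesis by (simp add: ddm_idx_def)
qed

lemma ddm_cov_le_1:
  assumes "prob_space PZ"
  shows "ddm_cov kind p \<kappa> \<sigma> PZ Ihat y B \<le> 1"
proof (cases kind)
  case Mixed
  have "(\<Sum>I\<in>{0..p}. pi_tilde_cond p \<sigma> PZ I y B * pi_tilde_idx p \<kappa> \<sigma> y I) \<le>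
      (\<Sum>I\<in>{0..p}. 1 * pi_tilde_idx p \<kappa> \<sigma> y I)"
    using prob_space.prob_le_1[OF assms]
    by (intro sum_mono mult_right_mono pi_tilde_idx_nonneg) (simp add: pi_tilde_cond_def)
  then show ?thesis using Mixed by (simp add: ddm_cov_def sum_pi_tilde_idx)
next
  case Selected
  then show ?thesis using prob_space.prob_le_1[OF assms] by (simp add: ddm_cov_def pi_tilde_cond_def)
qed

text \<open>The event is contained in E; h is slack that lets the bound take the required
  form.\<close>

lemma emeasure_le_bad_event:
  assumes E: "E \<in> sets P" "emeasure P E \<le> ennreal q" and h: "0 \<le> h"
    and Q: "\<And>X. X \<in> space P - E \<Longrightarrow> \<not> Q X"
  shows "emeasure P {X \<in> space P. Q X} \<le> ennreal (q + h)"
proof -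
  have "emeasure P {X \<in> space P. Q X} \<le> emeasure P E"
    using Q by (intro emeasure_mono E) auto
  also have "\<dots> \<le> ennreal (q + h)" using E(2) h by (meson add_increasing2 ennreal_leI order.refl order.trans)
  finally show ?thesis .
qed

lemma nn_integral_le_bad_event:
  fixes f :: "'a \<Rightarrow> real"
  assumes P: "prob_space P" and E: "E \<in> sets P" "emeasure P E \<le> ennreal q"
    and h: "0 \<le> h" and q: "0 \<le> q"
    and f1: "\<And>X. f X \<le> 1" and f: "\<And>X. X \<in> space P - E \<Longrightarrow> f X \<le> h"
  shows "(\<integral>\<^sup>+ X. ennreal (f X) \<partial>P) \<le> ennreal (q + h)"
proof -
  have "ennreal (f X) \<le> indicator E X + ennreal h" if "X \<in> space P" for X
  proof (cases "X \<in> E")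
    case True
    then show ?thesis using f1[of X] ennreal_leI[of "f X" 1] by (simp add: add_increasing2)
  next
    case False
    then show ?thesis using f[of X] that by (simp add: ennreal_leI)
  qed
  then have "(\<integral>\<^sup>+ X. ennreal (f X) \<partial>P) \<le> (\<integral>\<^sup>+ X. indicator E X + ennreal h \<partial>P)"
    by (rule nn_integral_mono)
  also have "\<dots> = emeasure P E + ennreal h"
    using E(1) prob_space.emeasure_space_1[OF P] by (simp add: nn_integral_add)
  also have "\<dots> \<le> ennreal q + ennreal h" using E(2) by (rule add_right_mono)
  finally show ?thesis using q h by simp
qed

text \<open>Concentration at t = \<open>\<sigma> / sqrt 2\<close> has exponent n \<sigma>^2 / 64 = 5
  n \<sigma>^2 / 320, which is stronger than the stated one since \<epsilon> \<le> 1. For \<sigma> =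
  0 the whole space serves as bad event.\<close>

lemma exists_bad_event:
  assumes S: "S \<in> cov_class p \<epsilon> \<inter> moment_class p" and "\<epsilon> > 0" and n: "n \<ge> 1" and p: "p \<ge> 1"
    and \<sigma>: "0 \<le> \<sigma>" "\<sigma> \<le> 1" and "\<nu> > 0" "\<kappa> \<ge> 8 * \<nu> + 5 / 2" "c\<^sub>3 \<ge> 6 + 4 * \<kappa>"
  shows "\<exists>E\<in>sets (sample_law n p S).
    emeasure (sample_law n p S) E \<le>
      ennreal (4 * exp (- (3 * \<epsilon> ^ 4 / 320) * real n * \<sigma>\<^sup>2 + 2 * ln (real p))) \<and>
    (\<forall>X\<in>space (sample_law n p S) - E. good_event p \<sigma> \<kappa> \<nu> c\<^sub>3 S (sample_cov n p X))"
proof -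
  let ?P = "sample_law n p S"
  interpret P: prob_space ?P by (rule prob_space_sample_law)
  have cov: "covariance_mat p S" and m: "S \<in> moment_class p"
    and "\<epsilon> \<le> 1 / \<epsilon>" using S by (auto simp: cov_class_def)
  then have "\<epsilon> * \<epsilon> \<le> 1" using \<open>\<epsilon> > 0\<close> by (simp add: field_simps)
  then have "\<epsilon> \<le> 1" using \<open>\<epsilon> > 0\<close> mult_strict_mono[of 1 \<epsilon> 1 \<epsilon>] by (cases "\<epsilon> \<le> 1") auto
  then have e4: "\<epsilon> ^ 4 \<le> 1" using \<open>\<epsilon> > 0\<close> by (simp add: power_le_one)
  have q: "4 * exp (- (3 * \<epsilon> ^ 4 / 320) * real n * \<sigma>\<^sup>2 + 2 * ln (real p)) =
      4 * (real p)\<^sup>2 * exp (- (3 * \<epsilon> ^ 4 / 320) * real n * \<sigma>\<^sup>2)"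
  proof -
    have "exp (2 * ln (real p)) = (real p)\<^sup>2"
      using p exp_of_nat_mult[of 2 "ln (real p)"] by simp
    then show ?thesis unfolding exp_add by simp
  qed
  show ?thesis
  proof (cases "\<sigma> = 0")
    case True
    have "1 \<le> (real p)\<^sup>2" using p by (intro one_le_power) simp
    then have "1 \<le> 4 * (real p)\<^sup>2" by linarith
    then show ?thesis
      unfolding q using True by (intro bexI[of _ "space ?P"]) (auto simp: P.emeasure_space_1)
  next
    case False
    then have \<sigma>0: "\<sigma> > 0" using \<sigma> by simp
    have s2: "\<sigma> / sqrt 2 \<le> 1" "(\<sigma> / sqrt 2)\<^sup>2 = \<sigma>\<^sup>2 / 2"
      using \<sigma> order.trans[of \<sigma> 1 "sqrt 2"] by (auto simp: power_divide)
    obtain E where E: "E \<in> sets ?P"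
      "emeasure ?P E \<le> ennreal (4 * (real p)\<^sup>2 * exp (- (real n * (\<sigma> / sqrt 2)\<^sup>2 / 32)))"
      "\<And>X i j. X \<in> space ?P - E \<Longrightarrow> i < p \<Longrightarrow> j < p \<Longrightarrow> \<bar>sample_cov n p X (i, j) - S (i, j)\<bar> \<le> \<sigma> / sqrt 2"
      using sample_cov_concentration[OF cov m n _ s2(1)] \<sigma> by auto
    have "3 * \<epsilon> ^ 4 / 320 * (real n * \<sigma>\<^sup>2) \<le> 1 / 64 * (real n * \<sigma>\<^sup>2)"
      using e4 by (intro mult_right_mono) auto
    then have "4 * (real p)\<^sup>2 * exp (- (real n * (\<sigma> / sqrt 2)\<^sup>2 / 32)) \<le>
        4 * (real p)\<^sup>2 * exp (- (3 * \<epsilon> ^ 4 / 320) * real n * \<sigma>\<^sup>2)"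
      unfolding s2(2) by (intro mult_left_mono) auto
    then have "emeasure ?P E \<le> ennreal (4 * (real p)\<^sup>2 * exp (- (3 * \<epsilon> ^ 4 / 320) * real n * \<sigma>\<^sup>2))"
      using E(2) by (meson ennreal_leI order.trans)
    moreover have "good_event p \<sigma> \<kappa> \<nu> c\<^sub>3 S (sample_cov n p X)" if X: "X \<in> space ?P - E" for X
    proof
      show "S (i, j) = S (j, i)" if "i < p" "j < p" for i j
        using cov that by (simp add: covariance_mat_def)
      show "sample_cov n p X (i, j) = sample_cov n p X (j, i)" if "i < p" "j < p" for i j
        using that by (simp add: sample_cov_def idx_def mult.commute)
      show "sample_cov n p X \<in> space (mat_space p)"
        by (auto simp: sample_cov_def mat_space_def space_PiM)
      show "(sample_cov n p X ij - S ij)\<^sup>2 \<le> \<sigma>\<^sup>2 / 2" if "ij \<in> idx p" for ij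
      proof -
        have "\<bar>sample_cov n p X ij - S ij\<bar> \<le> \<sigma> / sqrt 2"
          using E(3)[OF X] that by (auto simp: idx_def)
        then have "\<bar>sample_cov n p X ij - S ij\<bar>\<^sup>2 \<le> (\<sigma> / sqrt 2)\<^sup>2" by (rule power_mono) simp
        then show ?thesis by (simp add: s2)
      qed
    qed fact+
    ultimately show ?thesis unfolding q using E(1) by blast
  qed
qed

lemma frob_mdiff_commute: "frob p (mdiff p x y) = frob p (mdiff p y x)"
  unfolding frob_def L2_set_def by (simp add: mdiff_def power2_commute)

theorem theorem19p1:
  fixes \<epsilon>\<^sub>0 \<nu> \<kappa> \<delta> \<tau>\<^sub>0 :: real and kind :: ddm
  assumes "\<epsilon>\<^sub>0 > 0" and "\<nu> > 0"
    and "\<kappa> > (32 * \<nu> + 10 + alpha \<epsilon>\<^sub>0) / (4 * alpha \<epsilon>\<^sub>0)"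
    and "0 < \<delta>" and "\<delta> < 1"
    and "\<tau>\<^sub>0 > (1 + \<delta>) / (1 - \<delta>) * tau_bar \<epsilon>\<^sub>0 \<kappa>"
  shows "\<exists>M\<^sub>0 M\<^sub>1 M\<^sub>2 M\<^sub>3 H\<^sub>0 H\<^sub>1 H\<^sub>2 H\<^sub>3 m\<^sub>0 m\<^sub>1 m\<^sub>2 m\<^sub>3 :: real.
    M\<^sub>0 > 0 \<and> M\<^sub>1 > 0 \<and> M\<^sub>2 > 0 \<and> M\<^sub>3 > 0 \<and> H\<^sub>0 > 0 \<and> H\<^sub>1 > 0 \<and> H\<^sub>2 > 0 \<and> H\<^sub>3 > 0 \<and>
    m\<^sub>0 > 0 \<and> m\<^sub>1 > 0 \<and> m\<^sub>2 > 0 \<and> m\<^sub>3 > 0 \<and>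
    (\<forall>(n::nat) (p::nat) (\<sigma>::real) PZ Ihat Istar (M::real) (t::real).
      n \<ge> 1 \<longrightarrow> p \<ge> 1 \<longrightarrow> 0 \<le> \<sigma> \<longrightarrow> \<sigma> \<le> 1 \<longrightarrow>
      admissible_Z p (alpha \<epsilon>\<^sub>0) PZ \<longrightarrow>
      index_selector p \<kappa> \<sigma> Ihat \<longrightarrow>
      tau_oracle p \<sigma> \<tau>\<^sub>0 Istar \<longrightarrow>
      M \<ge> 0 \<longrightarrow> t \<ge> 0 \<longrightarrow>
      (let
         c\<^sub>2 = alpha \<epsilon>\<^sub>0 / 16;
         c\<^sub>3 = 6 / alpha \<epsilon>\<^sub>0 + 4 * \<kappa>;
         C\<^sub>\<nu> = exp \<nu> / (exp \<nu> - 1);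
         q = 4 * exp (- (3 * \<epsilon>\<^sub>0 ^ 4 / 320) * real n * \<sigma>\<^sup>2 + 2 * ln (real p));
         C = cov_class p \<epsilon>\<^sub>0 \<inter> moment_class p;
         P = sample_law n p;
         Y = sample_cov n p;
         \<Sigma>hat = (\<lambda>X. ddm_mean kind p \<kappa> \<sigma> Ihat (Y X));
         rhat_sq = (\<lambda>X. rhat2 p \<sigma> Ihat (Y X));
         R = (\<lambda>X. sqrt ((t + 1) * M\<^sub>2 * rhat_sq X + (t + 2) * M * \<sigma>\<^sup>2))
       in
         (SUP S\<in>C. \<integral>\<^sup>+ X. ennreal (ddm_cov kind p \<kappa> \<sigma> PZ Ihat (Y X)
             {T \<in> space (mat_space p). (frob p (mdiff p T S))\<^sup>2 \<ge> M\<^sub>0 * oracle_rate2 p \<sigma> S + M * \<sigma>\<^sup>2}) \<partial>P S)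
           \<le> ennreal (q + H\<^sub>0 * exp (- m\<^sub>0 * M)) \<and>
         (SUP S\<in>C. emeasure (P S) {X \<in> space (P S).
             (frob p (mdiff p (\<Sigma>hat X) S))\<^sup>2 \<ge> M\<^sub>1 * oracle_rate2 p \<sigma> S + M * \<sigma>\<^sup>2})
           \<le> ennreal (q + H\<^sub>1 * exp (- m\<^sub>1 * M)) \<and>
         (SUP S\<in>C. \<integral>\<^sup>+ X. ennreal (ddm_idx kind p \<kappa> \<sigma> Ihat (Y X)
             {I. rate2 p \<sigma> I S \<ge> c\<^sub>3 * oracle_rate2 p \<sigma> S + M * \<sigma>\<^sup>2}) \<partial>P S)
           \<le> ennreal (q + C\<^sub>\<nu> * exp (- c\<^sub>2 * M)) \<and>
         (SUP S\<in>C. emeasure (P S) {X \<in> space (P S).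
             rhat_sq X \<ge> M\<^sub>3 * oracle_rate2 p \<sigma> S + (M + 1) * \<sigma>\<^sup>2})
           \<le> ennreal (q + H\<^sub>3 * exp (- m\<^sub>3 * M)) \<and>
         (SUP S\<in>C \<inter> Theta_eb p \<sigma> Istar t. emeasure (P S) {X \<in> space (P S).
             S \<notin> frob_cball p (\<Sigma>hat X) (R X)})
           \<le> ennreal (q + H\<^sub>2 * exp (- m\<^sub>2 * M))))"
proof -
  note \<epsilon> = assms(1) and \<nu> = assms(2)
  define a where "a = alpha \<epsilon>\<^sub>0"
  define c3 where "c3 = 6 / a + 4 * \<kappa>"
  define C where "C = exp \<nu> / (exp \<nu> - 1)"
  have a: "0 < a" "a \<le> 1" using \<epsilon> by (auto simp: a_def alpha_def)
  have C: "C > 0" using \<nu> by (simp add: C_def)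
  have inv: "x \<le> x / a" if "x \<ge> 0" for x :: real
    using a that mult_right_le_one_le[of x a] by (simp add: pos_le_divide_eq)
  \<comment> \<open>Dividing by a \<le> 1 can only increase a nonnegative number, so a lower bound
    free of a survives.\<close>
  have \<kappa>: "\<kappa> \<ge> 8 * \<nu> + 5 / 2"
  proof -
    have "(32 * \<nu> + 10 + a) / (4 * a) = (8 * \<nu> + 5 / 2) / a + 1 / 4"
      using a by (simp add: field_simps)
    then show ?thesis using assms(3) inv[of "8 * \<nu> + 5 / 2"] \<nu> by (simp add: a_def)
  qed
  have c3: "c3 \<ge> 6 + 4 * \<kappa>" using inv[of 6] by (simp add: c3_def)
  have c3_pos: "c3 > 0" using c3 \<kappa> \<nu> by linarith
  \<comment> \<open>The factor (1 + \<delta>)/(1 - \<delta>) is at least 1, and 3/a \<ge> 3.\<close>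
  have \<tau>: "\<tau>\<^sub>0 > 3 * \<kappa> + 3"
  proof -
    have tb: "tau_bar \<epsilon>\<^sub>0 \<kappa> = 3 * \<kappa> + 3 / a" using a by (simp add: tau_bar_def a_def[symmetric] field_simps)
    then have "3 * \<kappa> + 3 \<le> tau_bar \<epsilon>\<^sub>0 \<kappa>" using inv[of 3] by simp
    moreover from this have "tau_bar \<epsilon>\<^sub>0 \<kappa> \<ge> 0" using \<kappa> \<nu> by linarith
    then have "1 * tau_bar \<epsilon>\<^sub>0 \<kappa> \<le> (1 + \<delta>) / (1 - \<delta>) * tau_bar \<epsilon>\<^sub>0 \<kappa>"
      using assms(4,5) by (intro mult_right_mono) auto
    ultimately show ?thesis using assms(6) by linarith
  qed
  \<comment> \<open>M0 is the constant of \<open>ddm_cov_tail\<close>. M1 is that of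
    \<open>ddm_mean_error\<close> plus 1: since the oracle rate is positive, the error bound becomes
    strict.\<close>
  define M0 M1 where "M0 = 2 * c3 * (1 + 1 / a)" and "M1 = c3 + 16 * C + 1"
  show ?thesis
  \<comment> \<open>M1 serves both for the mean and for the radius. The constants H and m equal to 1
    belong to the events contained in the bad event, where any positive values would do.\<close>
  proof (rule exI[of _ M0], rule exI[of _ M1], rule exI[of _ M1], rule exI[of _ c3],
      rule exI[of _ "1 + C"], rule exI[of _ "1 :: real"], rule exI[of _ "1 :: real"], rule exI[of _ "1 :: real"],
      rule exI[of _ "a / 128"], rule exI[of _ "1 :: real"], rule exI[of _ "1 :: real"], rule exI[of _ "1 :: real"],
      intro conjI allI impI, goal_cases)
    \<comment> \<open>The twelve goals before this one are the positivity claims, settled at the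
      end.\<close>
    case (13 n p \<sigma> PZ Ihat Istar M t)
    note n = 13(1) and p = 13(2) and \<sigma> = 13(3,4) and Z = 13(5) and sel = 13(6) and star = 13(7)
      and M = 13(8) and t = 13(9)
    note Z' = Z[folded a_def]
    have PZ: "prob_space PZ" using Z by (simp add: admissible_Z_def)
    define q where "q = 4 * exp (- (3 * \<epsilon>\<^sub>0 ^ 4 / 320) * real n * \<sigma>\<^sup>2 + 2 * ln (real p))"
    have q: "q \<ge> 0" by (simp add: q_def)
    let ?P = "sample_law n p" and ?Y = "sample_cov n p"
    have bad: "\<exists>E\<in>sets (?P S). emeasure (?P S) E \<le> ennreal q \<and>
        (\<forall>X\<in>space (?P S) - E. good_event p \<sigma> \<kappa> \<nu> c3 S (?Y X))"
      if "S \<in> cov_class p \<epsilon>\<^sub>0 \<inter> moment_class p" for S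
      unfolding q_def by (rule exists_bad_event[OF that \<epsilon> n p \<sigma> \<nu> \<kappa> c3])
    have mean: "(frob p (mdiff p (ddm_mean kind p \<kappa> \<sigma> Ihat (?Y X)) S))\<^sup>2 < M1 * oracle_rate2 p \<sigma> S"
      if "good_event p \<sigma> \<kappa> \<nu> c3 S (?Y X)" for S X
    proof -
      interpret good_event p \<sigma> \<kappa> \<nu> c3 S "?Y X" by (rule that)
      show ?thesis
        using ddm_mean_error[OF sel, of kind] R_pos by (simp add: M1_def C_def algebra_simps)
    qed
    have M\<sigma>: "0 \<le> M * \<sigma>\<^sup>2" using M by simp
    show ?case
      unfolding Let_def q_def[symmetric] a_def[symmetric] c3_def[symmetric] C_def[symmetric]
    proof (intro conjI SUP_least, goal_cases)
      case (1 S)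
      then obtain E where E: "E \<in> sets (?P S)" "emeasure (?P S) E \<le> ennreal q"
        "\<And>X. X \<in> space (?P S) - E \<Longrightarrow> good_event p \<sigma> \<kappa> \<nu> c3 S (?Y X)" using bad by blast
      show ?case
      proof (rule nn_integral_le_bad_event[OF prob_space_sample_law E(1,2)])
        fix X assume "X \<in> space (?P S) - E"
        then interpret good_event p \<sigma> \<kappa> \<nu> c3 S "?Y X" by (rule E(3))
        show "ddm_cov kind p \<kappa> \<sigma> PZ Ihat (?Y X)
            {T \<in> space (mat_space p). (frob p (mdiff p T S))\<^sup>2 \<ge> M0 * oracle_rate2 p \<sigma> S + M * \<sigma>\<^sup>2}
          \<le> (1 + C) * exp (- (a / 128) * M)"
          unfolding M0_def C_def by (rule ddm_cov_tail[OF sel a Z' M])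
      qed (use q C in \<open>auto intro: ddm_cov_le_1[OF PZ]\<close>)
    next
      case (2 S)
      then obtain E where E: "E \<in> sets (?P S)" "emeasure (?P S) E \<le> ennreal q"
        "\<And>X. X \<in> space (?P S) - E \<Longrightarrow> good_event p \<sigma> \<kappa> \<nu> c3 S (?Y X)" using bad by blast
      show ?case
      proof (rule emeasure_le_bad_event[OF E(1,2)])
        fix X assume "X \<in> space (?P S) - E"
        from mean[OF E(3)[OF this]] M\<sigma>
        show "\<not> (frob p (mdiff p (ddm_mean kind p \<kappa> \<sigma> Ihat (?Y X)) S))\<^sup>2 \<ge>
            M1 * oracle_rate2 p \<sigma> S + M * \<sigma>\<^sup>2"
          by simp
      qed simp
    next
      case (3 S)
      then obtain E where E: "E \<in> sets (?P S)" "emeasure (?P S) E \<le> ennreal q"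
        "\<And>X. X \<in> space (?P S) - E \<Longrightarrow> good_event p \<sigma> \<kappa> \<nu> c3 S (?Y X)" using bad by blast
      show ?case
      proof (rule nn_integral_le_bad_event[OF prob_space_sample_law E(1,2)])
        fix X assume "X \<in> space (?P S) - E"
        then interpret good_event p \<sigma> \<kappa> \<nu> c3 S "?Y X" by (rule E(3))
        have "ddm_idx kind p \<kappa> \<sigma> Ihat (?Y X) {I. rate2 p \<sigma> I S \<ge> c3 * oracle_rate2 p \<sigma> S + M * \<sigma>\<^sup>2}
          \<le> C * exp (- M / 16)"
          unfolding C_def by (rule ddm_idx_bad[OF sel M])
        also have "\<dots> \<le> C * exp (- (a / 16) * M)"
          using C a M mult_left_le_one_le[of M a] by (intro mult_left_mono) auto
        finally show "ddm_idx kind p \<kappa> \<sigma> Ihat (?Y X) {I. rate2 p \<sigma> I S \<ge> c3 * oracle_rate2 p \<sigma> S + M * \<sigma>\<^sup>2}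
          \<le> C * exp (- (a / 16) * M)" .
      qed (use q C in \<open>auto intro: ddm_idx_le_1\<close>)
    next
      case (4 S)
      then obtain E where E: "E \<in> sets (?P S)" "emeasure (?P S) E \<le> ennreal q"
        "\<And>X. X \<in> space (?P S) - E \<Longrightarrow> good_event p \<sigma> \<kappa> \<nu> c3 S (?Y X)" using bad by blast
      show ?case
      proof (rule emeasure_le_bad_event[OF E(1,2)])
        fix X assume "X \<in> space (?P S) - E"
        then interpret good_event p \<sigma> \<kappa> \<nu> c3 S "?Y X" by (rule E(3))
        \<comment> \<open>The further \<open>\<sigma>\<^sup>2\<close> in \<open>rhat2\<close> is
          matched by the 1 in M + 1.\<close>
        have "\<sigma>\<^sup>2 * rho p (Ihat (?Y X)) < c3 * R"
          using selector_rate[OF sel] bias2_nonneg[of p "Ihat (?Y X)" S] by (simp add: rate2_def)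
        then show "\<not> rhat2 p \<sigma> Ihat (?Y X) \<ge> c3 * oracle_rate2 p \<sigma> S + (M + 1) * \<sigma>\<^sup>2"
          using M\<sigma> by (simp add: rhat2_def distrib_right)
      qed simp
    next
      case (5 S)
      then obtain E where E: "E \<in> sets (?P S)" "emeasure (?P S) E \<le> ennreal q"
        "\<And>X. X \<in> space (?P S) - E \<Longrightarrow> good_event p \<sigma> \<kappa> \<nu> c3 S (?Y X)" using bad by blast
      have S: "S \<in> space (mat_space p)" and \<Theta>: "bias2 p (Istar S) S \<le> t * \<sigma>\<^sup>2 * (1 + rho p (Istar S))"
        using 5 by (auto simp: Theta_eb_def)
      have star_min: "Istar S \<le> p" "\<And>I. I \<le> p \<Longrightarrow>
          bias2 p (Istar S) S + \<tau>\<^sub>0 * \<sigma>\<^sup>2 * rho p (Istar S) \<le> bias2 p I S + \<tau>\<^sub>0 * \<sigma>\<^sup>2 * rho p I"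
        using star S by (auto simp: tau_oracle_def is_arg_min_def not_less)
      show ?case
      proof (rule emeasure_le_bad_event[OF E(1,2)])
        fix X assume X: "X \<in> space (?P S) - E"
        then interpret good_event p \<sigma> \<kappa> \<nu> c3 S "?Y X" by (rule E(3))
        let ?\<Sigma> = "ddm_mean kind p \<kappa> \<sigma> Ihat (?Y X)" and ?r = "rhat2 p \<sigma> Ihat (?Y X)"
        \<comment> \<open>Here excessive bias is excluded: on \<open>Theta_eb\<close> the bias at
          Istar is at most t times its variance part, and \<open>selector_rho\<close> bounds the
          dimension of Istar by the selected one. So the unknown oracle rate is at most (t + 1)
          times the observable \<open>rhat2\<close>.\<close>
        have "R \<le> t * \<sigma>\<^sup>2 * (1 + rho p (Istar S)) + \<sigma>\<^sup>2 * rho p (Istar S)"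
          using R_le[OF star_min(1)] \<Theta> by (simp add: rate2_def)
        also have "\<dots> \<le> (t + 1) * (\<sigma>\<^sup>2 * (1 + rho p (Istar S)))"
          by (simp add: algebra_simps)
        also have "\<dots> \<le> (t + 1) * ?r"
          using selector_rho[OF sel star_min(1) \<tau> star_min(2)] t
          by (auto simp: rhat2_def distrib_left intro!: mult_left_mono)
        finally have "M1 * R \<le> M1 * ((t + 1) * ?r)"
          using c3_pos C by (intro mult_left_mono) (auto simp: M1_def)
        have "(frob p (mdiff p S ?\<Sigma>))\<^sup>2 \<le> (t + 1) * M1 * ?r + (t + 2) * M * \<sigma>\<^sup>2"
        proof -
          have "0 \<le> (t + 2) * M * \<sigma>\<^sup>2" using t M by simp
          moreover have "M1 * ((t + 1) * ?r) = (t + 1) * M1 * ?r" by simp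
          ultimately show ?thesis
            using mean[OF E(3)[OF X]] \<open>M1 * R \<le> M1 * ((t + 1) * ?r)\<close>
            unfolding frob_mdiff_commute[of p S] by linarith
        qed
        then show "\<not> S \<notin> frob_cball p ?\<Sigma> (sqrt ((t + 1) * M1 * ?r + (t + 2) * M * \<sigma>\<^sup>2))"
          using S by (simp add: frob_cball_def real_le_rsqrt)
      qed simp
    qed
  qed (use a C c3_pos in \<open>auto simp: M0_def M1_def intro!: mult_pos_pos add_pos_pos\<close>)
qed

end
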